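(* Let $n\ge 2$ be even, let $p=2$, and consider $G=S_n$ with $\tau$ trivial and $c$ generic. Then $M_c/J_c$ is a complete intersection, with $J_c$ generated by $n-1$ homogeneous elements of degree $2$ and one homogeneous element of degree $4$. Thus $h_{L_c}(t)=(1+t)^n(1+t^2)$.
   Context: "$c$ generic" means that $c$ is an indeterminate and the ground field is $K=\mathbf{F}_p(c)$ (here $p=2$). The group $S_n$ acts on $K[x_1,\dots,x_n]$ by permuting the variables; $s_{kj}$ denotes the transposition of $x_k$ and $x_j$. The Dunkl operators are $D_k=\frac{\partial}{\partial x_k}-c\sum_{j\neq k}\frac{1}{x_k-x_j}(1-s_{kj})$, $k=1,\dots,n$. The rational Cherednik algebra $H_{1,c}(S_n,\mathfrak h)$, with $\mathfrak h=K^n$ the permutation representation with basis $y_1,\dots,y_n$, acts on the Verma module $M_c=M_c(S_n,\mathfrak h,\mathrm{triv})=K[x_1,\dots,x_n]$ (graded by degree): $x_k$ acts by multiplication, $S_n$ by permutations, and $y_k$ by $D_k$. A graded submodule of $M_c$ is thus a homogeneous ideal stable under $S_n$ and all $D_k$. $J_c$ denotes the unique maximal proper graded submodule of $M_c$, and $L_c=M_c/J_c$. The Hilbert series is $h_{L_c}(t)=\sum_{d\ge 0}\dim_K (L_c)_d\,t^d$. "Complete intersection" means that the quotient of $K[x_1,\dots,x_n]$ is by an ideal generated by a regular sequence. *)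

theory Defs
  imports
    "HOL-Library.Z2"
    "HOL-Library.Poly_Mapping"
    "HOL-Combinatorics.Permutations"
    "HOL-Computational_Algebra.Polynomial"
    "HOL-Computational_Algebra.Fraction_Field"
    "HOL-Computational_Algebra.Formal_Power_Series"
    "HOL-Algebra.QuotRing"
    "HOL-Algebra.Embedded_Algebras"
begin

section \<open>The ground field\<close>

type_synonym F2c = "bit poly fract"

definition cgen :: F2c where
  "cgen = Fract [:0, 1:] 1"

section \<open>Polynomials in \<open>x\<^sub>1, \<dots>, x\<^sub>n\<close>\<close>

text \<open>
  Polynomials are finitely supported functions from exponent vectors to coefficients, with the
  convolution product of \<^theory>\<open>HOL-Library.Poly_Mapping\<close>. The type has a variable for every
  natural number; the ring in \<open>x\<^sub>1, \<dots>, x\<^sub>n\<close> is carved out by its carrier.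
\<close>

type_synonym 'a mpoly = "(nat \<Rightarrow>\<^sub>0 nat) \<Rightarrow>\<^sub>0 'a"

definition mconst :: "'a::field \<Rightarrow> 'a mpoly" where
  "mconst a = Poly_Mapping.single 0 a"

definition X :: "nat \<Rightarrow> 'a::field mpoly" where
  "X k = Poly_Mapping.single (Poly_Mapping.single k 1) 1"

definition mpolys :: "nat \<Rightarrow> 'a::field mpoly set" where
  "mpolys n = {f. \<forall>m \<in> Poly_Mapping.keys f. Poly_Mapping.keys m \<subseteq> {1..n}}"

definition mpoly_ring :: "nat \<Rightarrow> 'a::field mpoly ring" where
  "mpoly_ring n = \<lparr>carrier = mpolys n, mult = (*), one = 1, zero = 0, add = (+)\<rparr>"

definition mdeg :: "(nat \<Rightarrow>\<^sub>0 nat) \<Rightarrow> nat" where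
  "mdeg m = (\<Sum>i\<in>Poly_Mapping.keys m. Poly_Mapping.lookup m i)"

text \<open>The zero polynomial is homogeneous of every degree.\<close>

definition homogeneous :: "nat \<Rightarrow> 'a::field mpoly \<Rightarrow> bool" where
  "homogeneous d f \<longleftrightarrow> (\<forall>m \<in> Poly_Mapping.keys f. mdeg m = d)"

definition hom_component :: "nat \<Rightarrow> 'a::field mpoly \<Rightarrow> 'a mpoly" where
  "hom_component d f = (\<Sum>m | m \<in> Poly_Mapping.keys f \<and> mdeg m = d. Poly_Mapping.single m (Poly_Mapping.lookup f m))"

section \<open>Dunkl operators\<close>

text \<open>The substitution \<open>x\<^sub>i \<mapsto> x\<^bsub>\<sigma> i\<^esub>\<close>.\<close>

definition perm_act :: "(nat \<Rightarrow> nat) \<Rightarrow> 'a::field mpoly \<Rightarrow> 'a mpoly" where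
  "perm_act \<sigma> f =
     (\<Sum>m\<in>Poly_Mapping.keys f. mconst (Poly_Mapping.lookup f m) * (\<Prod>i\<in>Poly_Mapping.keys m. X (\<sigma> i) ^ Poly_Mapping.lookup m i))"

text \<open>
  When \<open>x\<^sub>k\<close> does not occur in \<open>m\<close>, the truncated subtraction of exponents is harmless, since the
  coefficient is then \<open>0\<close>.
\<close>

definition pderiv_var :: "nat \<Rightarrow> 'a::field mpoly \<Rightarrow> 'a mpoly" where
  "pderiv_var k f =
     (\<Sum>m\<in>Poly_Mapping.keys f.
        Poly_Mapping.single (m - Poly_Mapping.single k 1)
          (of_nat (Poly_Mapping.lookup m k) * Poly_Mapping.lookup f m))"

text \<open>The exact quotient \<open>(f - s\<^sub>k\<^sub>j f) / (x\<^sub>k - x\<^sub>j)\<close>; see \<open>divided_difference_ex1\<close> below.\<close>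

definition divided_difference :: "nat \<Rightarrow> nat \<Rightarrow> 'a::field mpoly \<Rightarrow> 'a mpoly" where
  "divided_difference k j f = (THE q. (X k - X j) * q = f - perm_act (transpose k j) f)"

lemma mpoly_expand:
  "f = (\<Sum>m\<in>Poly_Mapping.keys f.
          mconst (Poly_Mapping.lookup f m) * (\<Prod>i\<in>Poly_Mapping.keys m. X i ^ Poly_Mapping.lookup m i))"
proof -
  have pow: "X i ^ e = Poly_Mapping.single (Poly_Mapping.single i e) (1::'a)" for i e
    by (induction e) (simp_all add: X_def mult_single flip: single_add)
  have prod: "(\<Prod>i\<in>S. X i ^ e i) = Poly_Mapping.single (\<Sum>i\<in>S. Poly_Mapping.single i (e i)) (1::'a)"
    if "finite S" for S :: "nat set" and e
    using that by (induction S) (simp_all add: pow mult_single)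
  have sum1: "(\<Sum>i\<in>Poly_Mapping.keys m. Poly_Mapping.single i (Poly_Mapping.lookup m i)) = m"
    for m :: "nat \<Rightarrow>\<^sub>0 nat"
    by (rule poly_mapping_eqI)
       (auto simp: lookup_sum lookup_single when_def in_keys_iff)
  have sum2: "(\<Sum>m\<in>Poly_Mapping.keys f. Poly_Mapping.single m (Poly_Mapping.lookup f m)) = f"
    by (rule poly_mapping_eqI)
       (auto simp: lookup_sum lookup_single when_def in_keys_iff)
  show ?thesis
    by (simp add: prod sum1 mconst_def mult_single sum2)
qed

lemma divided_difference_ex1:
  assumes "k \<noteq> j"
  shows "\<exists>!q. (X k - X j) * q = f - perm_act (transpose k j) f"
proof -
  let ?s = "transpose k j"
  let ?d = "X k - X j :: 'a mpoly"
  have "Poly_Mapping.lookup ?d (Poly_Mapping.single k 1) = 1"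
    using assms by (auto simp: X_def lookup_minus lookup_single when_def dest: arg_cong[where f = "\<lambda>m. Poly_Mapping.lookup m k"])
  then have nz: "?d \<noteq> 0" by auto
  have pw: "?d dvd X i ^ e - X (?s i) ^ e" for i e
  proof -
    have "a - b dvd a ^ e - b ^ e" for a b :: "'a mpoly"
      by (metis dvd_triv_left power_diff_sumr2)
    moreover have "?d dvd X i - X (?s i)"
      by (auto simp: transpose_def) (metis dvd_refl minus_diff_eq dvd_minus_iff)
    ultimately show ?thesis using dvd_trans by blast
  qed
  have prod: "?d dvd (\<Prod>i\<in>S. X i ^ e i) - (\<Prod>i\<in>S. X (?s i) ^ e i)"
    if "finite S" for S :: "nat set" and e
    using that
  proof (induction S)
    case (insert i S)
    let ?P = "\<Prod>i\<in>S. X i ^ e i :: 'a mpoly" and ?Q = "\<Prod>i\<in>S. X (?s i) ^ e i :: 'a mpoly"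
    have "X i ^ e i * ?P - X (?s i) ^ e i * ?Q = X i ^ e i * (?P - ?Q) + (X i ^ e i - X (?s i) ^ e i) * ?Q"
      by (simp add: algebra_simps)
    with insert pw show ?case by simp
  qed auto
  have "f - perm_act ?s f =
     (\<Sum>m\<in>Poly_Mapping.keys f. mconst (Poly_Mapping.lookup f m) *
        ((\<Prod>i\<in>Poly_Mapping.keys m. X i ^ Poly_Mapping.lookup m i) - (\<Prod>i\<in>Poly_Mapping.keys m. X (?s i) ^ Poly_Mapping.lookup m i)))"
    by (subst (1) mpoly_expand) (simp add: perm_act_def sum_subtractf algebra_simps)
  also have "?d dvd \<dots>"
    by (intro dvd_sum dvd_mult prod) simp
  finally obtain q where "f - perm_act ?s f = ?d * q" by (elim dvdE)
  with nz show ?thesis by (metis mult_left_cancel)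
qed

definition dunkl :: "'a::field \<Rightarrow> nat \<Rightarrow> nat \<Rightarrow> 'a mpoly \<Rightarrow> 'a mpoly" where
  "dunkl c n k f =
     pderiv_var k f - mconst c * (\<Sum>j\<in>{1..n} - {k}. divided_difference k j f)"

section \<open>Graded submodules of the Verma module and its irreducible quotient\<close>

definition graded_submodule :: "'a::field \<Rightarrow> nat \<Rightarrow> 'a mpoly set \<Rightarrow> bool" where
  "graded_submodule c n I \<longleftrightarrow>
     ideal I (mpoly_ring n) \<and>
     (\<forall>f\<in>I. \<forall>d. hom_component d f \<in> I) \<and>
     (\<forall>\<sigma>. \<sigma> permutes {1..n} \<longrightarrow> (\<forall>f\<in>I. perm_act \<sigma> f \<in> I)) \<and>
     (\<forall>k\<in>{1..n}. \<forall>f\<in>I. dunkl c n k f \<in> I)"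

text \<open>
  The \<open>THE\<close> in \<open>Jmax\<close> is justified by \<open>maximal_proper_graded_submodule_ex1\<close>.
\<close>

definition maximal_proper_graded_submodule :: "'a::field \<Rightarrow> nat \<Rightarrow> 'a mpoly set \<Rightarrow> bool" where
  "maximal_proper_graded_submodule c n J \<longleftrightarrow>
     graded_submodule c n J \<and> J \<noteq> mpolys n \<and>
     (\<forall>I. graded_submodule c n I \<and> I \<noteq> mpolys n \<and> J \<subseteq> I \<longrightarrow> I = J)"

lemma mpolys_closed:
  "0 \<in> mpolys n" "1 \<in> mpolys n" "mconst a \<in> mpolys n"
  "f \<in> mpolys n \<Longrightarrow> g \<in> mpolys n \<Longrightarrow> f + g \<in> mpolys n"
  "f \<in> mpolys n \<Longrightarrow> g \<in> mpolys n \<Longrightarrow> f * g \<in> mpolys n"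
  "f \<in> mpolys n \<Longrightarrow> - f \<in> mpolys n"
proof -
  assume f: "f \<in> mpolys n" and g: "g \<in> mpolys n"
  show "f + g \<in> mpolys n"
    using f g Poly_Mapping.keys_add[of f g] unfolding mpolys_def by blast
  show "f * g \<in> mpolys n"
    unfolding mpolys_def
  proof (intro CollectI ballI)
    fix m assume "m \<in> Poly_Mapping.keys (f * g)"
    then obtain a b where "m = a + b" "a \<in> Poly_Mapping.keys f" "b \<in> Poly_Mapping.keys g"
      using keys_mult[of f g] by blast
    then show "Poly_Mapping.keys m \<subseteq> {1..n}"
      using f g Poly_Mapping.keys_add[of a b] unfolding mpolys_def by blast
  qed
qed (auto simp: mpolys_def mconst_def)

lemma cring_mpoly_ring: "cring (mpoly_ring n)"
proof (rule cringI)
  show "abelian_group (mpoly_ring n)"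
    by (rule abelian_groupI)
       (auto simp: mpoly_ring_def mpolys_closed add.assoc add.commute
         intro!: bexI[of _ "- x" for x])
  show "comm_monoid (mpoly_ring n)"
    by unfold_locales (auto simp: mpoly_ring_def mpolys_closed mult.assoc mult.commute)
qed (auto simp: mpoly_ring_def distrib_right)

lemma ideal_mpoly_ring_iff:
  "ideal I (mpoly_ring n) \<longleftrightarrow>
     I \<subseteq> mpolys n \<and> 0 \<in> I \<and> (\<forall>f\<in>I. \<forall>g\<in>I. f + g \<in> I) \<and> (\<forall>f\<in>I. \<forall>g\<in>mpolys n. g * f \<in> I)"
  (is "_ \<longleftrightarrow> ?R")
proof
  assume "ideal I (mpoly_ring n)"
  then interpret ideal I "mpoly_ring n" .
  show ?R
    using a_subset additive_subgroup.zero_closed[OF is_additive_subgroup]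
      additive_subgroup.a_closed[OF is_additive_subgroup] I_l_closed
    by (auto simp: mpoly_ring_def)
next
  assume R: ?R
  interpret cring "mpoly_ring n :: 'a mpoly ring" by (rule cring_mpoly_ring)
  have neg: "- f \<in> I" if "f \<in> I" for f
  proof -
    have "(- 1) * f \<in> I" using R that mpolys_closed(2,6) by blast
    then show ?thesis by simp
  qed
  have inv: "\<ominus>\<^bsub>mpoly_ring n\<^esub> f = - f" if "f \<in> mpolys n" for f :: "'a mpoly"
    by (rule minus_equality) (use that in \<open>auto simp: mpoly_ring_def mpolys_closed\<close>)
  show "ideal I (mpoly_ring n)"
  proof (rule idealI)
    show "subgroup I (add_monoid (mpoly_ring n))"
      by (rule add.subgroupI) (use R neg inv in \<open>auto simp: mpoly_ring_def a_inv_def subset_iff\<close>)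
  qed (rule ring_axioms, use R in \<open>auto simp: mpoly_ring_def mult.commute\<close>)
qed

lemma hom_component_add: "hom_component d (f + g) = hom_component d f + hom_component d g"
proof -
  have "hom_component d h =
      (\<Sum>m\<in>Poly_Mapping.keys h. if mdeg m = d then Poly_Mapping.single m (Poly_Mapping.lookup h m) else 0)"
    for h :: "'a mpoly"
    unfolding hom_component_def by (subst sum.inter_filter[symmetric]) auto
  moreover have "(\<Sum>m\<in>Poly_Mapping.keys (f + g).
        if mdeg m = d then Poly_Mapping.single m (Poly_Mapping.lookup (f + g) m) else 0) =
      (\<Sum>m\<in>Poly_Mapping.keys f. if mdeg m = d then Poly_Mapping.single m (Poly_Mapping.lookup f m) else 0) +
      (\<Sum>m\<in>Poly_Mapping.keys g. if mdeg m = d then Poly_Mapping.single m (Poly_Mapping.lookup g m) else 0)"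
    by (rule setsum_keys_plus_distrib) (auto simp: single_add)
  ultimately show ?thesis by simp
qed

lemma perm_act_add: "perm_act \<sigma> (f + g) = perm_act \<sigma> f + perm_act \<sigma> g"
  unfolding perm_act_def
  by (rule setsum_keys_plus_distrib) (auto simp: mconst_def single_add distrib_right)

lemma pderiv_var_add: "pderiv_var k (f + g) = pderiv_var k f + pderiv_var k g"
  unfolding pderiv_var_def
  by (rule setsum_keys_plus_distrib) (auto simp: single_add distrib_left)

lemma divided_difference_add:
  assumes "k \<noteq> j"
  shows "divided_difference k j (f + g) = divided_difference k j f + divided_difference k j g"
proof -
  note ex1 = divided_difference_ex1[OF assms]
  have eq: "(X k - X j) * divided_difference k j h = h - perm_act (transpose k j) h" for h :: "'a mpoly"
    unfolding divided_difference_def by (rule theI'[OF ex1])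
  show ?thesis
    unfolding divided_difference_def[of k j "f + g"]
    by (rule the1_equality[OF ex1]) (simp add: distrib_left eq perm_act_add)
qed

lemma dunkl_add: "dunkl c n k (f + g) = dunkl c n k f + dunkl c n k g"
proof -
  have "(\<Sum>j\<in>{1..n} - {k}. divided_difference k j (f + g)) =
      (\<Sum>j\<in>{1..n} - {k}. divided_difference k j f) + (\<Sum>j\<in>{1..n} - {k}. divided_difference k j g)"
    unfolding sum.distrib[symmetric] by (rule sum.cong) (auto intro: divided_difference_add)
  then show ?thesis by (simp add: dunkl_def pderiv_var_add algebra_simps)
qed

lemma maximal_proper_graded_submodule_ex1: "\<exists>!J. maximal_proper_graded_submodule c n J"
proof -
  define U where "U = \<Union>{I. graded_submodule c n I \<and> I \<noteq> mpolys n}"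
  define J where "J = {sum_list fs | fs. set fs \<subseteq> U}"
  have map: "T f \<in> J"
    if add: "\<And>f g. T (f + g) = T f + T g" and U: "\<And>f. f \<in> U \<Longrightarrow> T f \<in> U" and f: "f \<in> J" for T f
  proof -
    have T0: "T 0 = 0" using add[of 0 0] by (metis add.right_neutral add_left_cancel)
    have "T (sum_list fs) = sum_list (map T fs)" for fs
      by (induction fs) (simp_all add: add T0)
    moreover obtain fs where "f = sum_list fs" "set fs \<subseteq> U" using f by (auto simp: J_def)
    moreover have "set (map T fs) \<subseteq> U" using U \<open>set fs \<subseteq> U\<close> by auto
    ultimately show ?thesis unfolding J_def by blast
  qed
  have hom0: "hom_component 0 f = 0" if f: "f \<in> U" for f
  proof (rule ccontr)
    assume nz: "hom_component 0 f \<noteq> 0"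
    from f obtain I where I: "graded_submodule c n I" "I \<noteq> mpolys n" "f \<in> I" by (auto simp: U_def)
    have "m = 0" if "mdeg m = 0" for m
      using that by (auto simp: mdeg_def in_keys_iff intro: poly_mapping_eqI)
    then have sub0: "{m. m \<in> Poly_Mapping.keys f \<and> mdeg m = 0} \<subseteq> {0}" by auto
    have "hom_component 0 f = 0 \<or> hom_component 0 f = mconst (Poly_Mapping.lookup f 0)"
      using subset_singletonD[OF sub0]
      by (rule disj_forward) (simp_all only: hom_component_def mconst_def, simp_all)
    with nz have eq: "hom_component 0 f = mconst (Poly_Mapping.lookup f 0)" by simp
    with nz have "Poly_Mapping.lookup f 0 \<noteq> 0" by (auto simp: mconst_def)
    then have "mconst (inverse (Poly_Mapping.lookup f 0)) * hom_component 0 f = 1"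
      unfolding eq by (simp add: mconst_def mult_single)
    moreover have "mconst (inverse (Poly_Mapping.lookup f 0)) * hom_component 0 f \<in> I"
      using I mpolys_closed(3) unfolding graded_submodule_def ideal_mpoly_ring_iff by blast
    ultimately have "1 \<in> I" by simp
    moreover have "g * f \<in> I" if "f \<in> I" "g \<in> mpolys n" for f g
      using I(1) that unfolding graded_submodule_def ideal_mpoly_ring_iff by blast
    ultimately have "g \<in> I" if "g \<in> mpolys n" for g
      using that by (metis mult.right_neutral)
    with I show False unfolding graded_submodule_def ideal_mpoly_ring_iff by blast
  qed
  have sub: "I \<subseteq> J" if "graded_submodule c n I" "I \<noteq> mpolys n" for I
  proof
    fix f assume "f \<in> I"
    with that have "set [f] \<subseteq> U" by (auto simp: U_def)
    moreover have "f = sum_list [f]" by simp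
    ultimately show "f \<in> J" unfolding J_def by blast
  qed
  have "J \<subseteq> mpolys n"
  proof -
    have U: "U \<subseteq> mpolys n" by (auto simp: U_def graded_submodule_def ideal_mpoly_ring_iff)
    have "sum_list fs \<in> mpolys n" if "set fs \<subseteq> U" for fs
      using that U by (induction fs) (auto simp: mpolys_closed)
    then show ?thesis by (auto simp: J_def)
  qed
  moreover have "0 \<in> J" unfolding J_def by (auto intro: exI[of _ "[]"])
  moreover have "f + g \<in> J" if fg: "f \<in> J" "g \<in> J" for f g
  proof -
    obtain fs gs where "f = sum_list fs" "set fs \<subseteq> U" "g = sum_list gs" "set gs \<subseteq> U"
      using fg unfolding J_def by blast
    then have "f + g = sum_list (fs @ gs)" "set (fs @ gs) \<subseteq> U" by auto
    then show ?thesis unfolding J_def by blast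
  qed
  moreover have "g * f \<in> J" if "f \<in> J" "g \<in> mpolys n" for f g
  proof (rule map[OF _ _ that(1)])
    show "g * f \<in> U" if "f \<in> U" for f
      using that \<open>g \<in> mpolys n\<close> unfolding U_def graded_submodule_def ideal_mpoly_ring_iff by blast
  qed (simp add: distrib_left)
  ultimately have "ideal J (mpoly_ring n)" unfolding ideal_mpoly_ring_iff by blast
  moreover have "hom_component d f \<in> J" if "f \<in> J" for d f
    by (rule map[OF hom_component_add _ that]) (unfold U_def graded_submodule_def, blast)
  moreover have "perm_act \<sigma> f \<in> J" if "f \<in> J" "\<sigma> permutes {1..n}" for \<sigma> f
    by (rule map[OF perm_act_add _ that(1)]) (use that(2) in \<open>unfold U_def graded_submodule_def, blast\<close>)
  moreover have "dunkl c n k f \<in> J" if "f \<in> J" "k \<in> {1..n}" for k f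
    by (rule map[OF dunkl_add _ that(1)]) (use that(2) in \<open>unfold U_def graded_submodule_def, blast\<close>)
  ultimately have J: "graded_submodule c n J" unfolding graded_submodule_def by blast
  have "hom_component 0 (sum_list fs) = 0" if "set fs \<subseteq> U" for fs
    using that by (induction fs) (simp_all add: hom_component_add hom0, simp add: hom_component_def)
  then have "hom_component 0 f = 0" if "f \<in> J" for f
    using that unfolding J_def by blast
  moreover have "hom_component 0 1 = (1 :: 'a mpoly)"
  proof -
    have "{m. m \<in> Poly_Mapping.keys (1 :: 'a mpoly) \<and> mdeg m = 0} = {0}"
      by (auto simp: mdeg_def)
    then show ?thesis by (simp add: hom_component_def)
  qed
  ultimately have "1 \<notin> J" by force
  then have proper: "J \<noteq> mpolys n" using mpolys_closed(2) by blast
  show ?thesis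
  proof (rule ex1I[of _ J])
    show "maximal_proper_graded_submodule c n J"
      using J proper sub unfolding maximal_proper_graded_submodule_def by blast
    show "I = J" if "maximal_proper_graded_submodule c n I" for I
      using that J proper sub unfolding maximal_proper_graded_submodule_def by blast
  qed
qed

definition Jmax :: "'a::field \<Rightarrow> nat \<Rightarrow> 'a mpoly set" where
  "Jmax c n = (THE J. maximal_proper_graded_submodule c n J)"

definition Lring :: "'a::field \<Rightarrow> nat \<Rightarrow> 'a mpoly set ring" where
  "Lring c n = mpoly_ring n Quot Jmax c n"

text \<open>
  The ground field, embedded in the quotient \<open>L\<^sub>c\<close> as the residue classes of the constants, and the
  degree \<open>d\<close> part of \<open>L\<^sub>c\<close>; \<^const>\<open>ring.dim\<close> is the dimension of a subspace over an embedded field.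
\<close>

definition Lconsts :: "'a::field \<Rightarrow> nat \<Rightarrow> 'a mpoly set set" where
  "Lconsts c n = (\<lambda>a. Jmax c n +>\<^bsub>mpoly_ring n\<^esub> mconst a) ` UNIV"

definition Lgraded :: "'a::field \<Rightarrow> nat \<Rightarrow> nat \<Rightarrow> 'a mpoly set set" where
  "Lgraded c n d = (\<lambda>f. Jmax c n +>\<^bsub>mpoly_ring n\<^esub> f) ` {f \<in> mpolys n. homogeneous d f}"

definition hilbert_series_L :: "'a::field \<Rightarrow> nat \<Rightarrow> int fps" where
  "hilbert_series_L c n =
     Abs_fps (\<lambda>d. int (ring.dim (Lring c n) (Lconsts c n) (Lgraded c n d)))"

section \<open>Regular sequences\<close>

text \<open>Each member is a non-zero-divisor modulo its predecessors, and the whole ideal is proper.\<close>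

definition regular_sequence :: "('r, 'm) ring_scheme \<Rightarrow> 'r list \<Rightarrow> bool" where
  "regular_sequence R fs \<longleftrightarrow>
     set fs \<subseteq> carrier R \<and>
     (\<forall>i<length fs. \<forall>g\<in>carrier R.
        fs ! i \<otimes>\<^bsub>R\<^esub> g \<in> Idl\<^bsub>R\<^esub> (set (take i fs)) \<longrightarrow> g \<in> Idl\<^bsub>R\<^esub> (set (take i fs))) \<and>
     Idl\<^bsub>R\<^esub> (set fs) \<noteq> carrier R"

end

theory Submission
  imports Defs "HOL-Computational_Algebra.Polynomial_Factorial"
begin

text \<open>
  Put \<open>s = x\<^sub>1 + \<dots> + x\<^sub>n\<close> and \<open>z\<^sub>i = x\<^sub>i + x\<^sub>1\<close> for \<open>1 < i < n\<close>. Since \<open>n\<close> is even, \<open>x\<^sub>1, z\<^sub>2, \<dots>, z\<^bsub>n-1\<^esub>, s\<close> are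
  coordinates, and \<open>J\<close> turns out to be generated by \<open>s\<^sup>2\<close>, \<open>z\<^sub>i\<^sup>2 + c s z\<^sub>i\<close> and \<open>x\<^sub>1\<^sup>4\<close>. These relations are
  triangular: products of monomials in the relations with monomials of degree less than 2 (for \<open>x\<^sub>1\<close>, 4)
  in every coordinate form a basis of the polynomial ring. Regularity and the Hilbert series can be
  read off from this basis.

  The quadrics in \<open>J\<close> are spanned by the differences of the elements \<open>u\<^sub>i = x\<^sub>i\<^sup>2 + c s x\<^sub>i\<close>, on which \<open>D\<^sub>k\<close> takes the value
  \<open>c x\<^sub>k + c\<^sup>2 s\<close> for every \<open>i\<close>; and \<open>D\<^sub>k x\<^sub>1\<^sup>4\<close> is a combination of cubes \<open>(x\<^sub>i + x\<^sub>j)\<^sup>3\<close>, which vanish modulo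
  the quadrics. Hence the ideal is a submodule.

  A strictly larger submodule contains the socle generator \<open>s x\<^sub>1\<^sup>3 z\<^sub>2 \<dots> z\<^bsub>n-1\<^esub>\<close>. Modulo \<open>c\<close> the Dunkl
  operators are partial derivatives, and \<open>D\<^sub>k + D\<^sub>n\<close> for \<open>k = 2, \<dots>, n - 1\<close> and \<open>k = 1\<close> strip the generator to
  \<open>s x\<^sub>1\<^sup>2\<close>. Then \<open>D\<^sub>1\<^sup>3\<close> yields \<open>c\<close> up to terms divisible by \<open>c\<^sup>2\<close>, so the constant term is not zero.
\<close>

abbreviation keys where "keys \<equiv> Poly_Mapping.keys"
abbreviation lookup where "lookup \<equiv> Poly_Mapping.lookup"
abbreviation single where "single \<equiv> Poly_Mapping.single"

section \<open>Linear maps on polynomials\<close>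

lemma mconst_add: "mconst (a + b) = mconst a + mconst b"
  by (simp add: mconst_def single_add)

lemma mconst_mult: "mconst (a * b) = mconst a * mconst b"
  by (simp add: mconst_def mult_single)

lemma mconst_0 [simp]: "mconst 0 = 0" and mconst_1 [simp]: "mconst 1 = 1"
  by (simp_all add: mconst_def)

lemma mconst_eq_0_iff [simp]: "mconst a = 0 \<longleftrightarrow> a = 0"
  by (metis lookup_single_eq mconst_def lookup_zero single_zero)

lemma X_power: "X i ^ e = single (single i e) 1"
  by (induction e) (simp_all add: X_def mult_single flip: single_add)

lemma X_mult_single: "X i * single m a = single (single i 1 + m) a"
  by (simp add: X_def mult_single)

lemma mconst_mult_single: "mconst a * single m b = single m (a * b)"
  by (simp add: mconst_def mult_single)

lemma lookup_mconst_mult: "lookup (mconst a * f) m = a * lookup f m"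
  unfolding mconst_def by (simp flip: mult_map_scale_conv_mult add: Poly_Mapping.map.rep_eq when_def)

lemma sum_single_lookup: "(\<Sum>m\<in>keys f. single m (lookup f m)) = f"
  by (rule poly_mapping_eqI) (auto simp: lookup_sum lookup_single when_def in_keys_iff)

text \<open>A term arises from its coefficient by multiplying with one variable at a time, and only
  variables occurring in it are used.\<close>

lemma single_induct [case_names const X]:
  assumes const: "P (mconst a)" and X: "\<And>i g. i \<in> keys m \<Longrightarrow> P g \<Longrightarrow> P (X i * g)"
  shows "P (single m a)"
proof -
  have pow: "P (X i ^ e * g)" if "i \<in> keys m" "P g" for i e g
    by (induction e) (use that X in \<open>simp_all add: mult.assoc\<close>)
  have prod: "P ((\<Prod>i\<in>S. X i ^ e i) * mconst a)" if "finite S" "S \<subseteq> keys m" for S e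
    using that by (induction S) (simp_all add: const pow mult.assoc)
  have "(\<Prod>i\<in>S. X i ^ e i) = single (\<Sum>i\<in>S. single i (e i)) (1::'a)" if "finite S" for S e
    using that by (induction S) (simp_all add: X_power mult_single)
  with prod[OF finite_keys order.refl, of "lookup m"] show ?thesis
    by (simp add: sum_single_lookup mconst_def mult_single)
qed

text \<open>Constants are restricted to coefficients of \<open>f\<close> so that an induction can
  track where coefficients lie, as in \<open>integral_divided_difference\<close>; \<open>V\<close>
  serves to stay within x_1, ..., x_n.\<close>

lemma mpoly_induct [consumes 1, case_names zero const X add]:
  assumes "\<And>m. m \<in> keys f \<Longrightarrow> keys m \<subseteq> V"
    and "P 0" and const: "\<And>m. m \<in> keys f \<Longrightarrow> P (mconst (lookup f m))"
    and X: "\<And>i g. i \<in> V \<Longrightarrow> P g \<Longrightarrow> P (X i * g)"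
    and add: "\<And>g h. P g \<Longrightarrow> P h \<Longrightarrow> P (g + h)"
  shows "P f"
proof -
  have single: "P (single m (lookup f m))" if "m \<in> keys f" for m
    by (rule single_induct) (use assms that in blast)+
  have "P (\<Sum>m\<in>A. single m (lookup f m))" if "finite A" "A \<subseteq> keys f" for A
    using that by (induction A) (auto intro: add single \<open>P 0\<close>)
  then show ?thesis
    by (metis finite_keys order.refl sum_single_lookup)
qed

text \<open>Substitutions, partial derivatives, homogeneous components and \<open>Phi\<close> all
  have this form, so linearity is proved once for all of them.\<close>

definition linext :: "((nat \<Rightarrow>\<^sub>0 nat) \<Rightarrow> 'a mpoly) \<Rightarrow> 'a::field mpoly \<Rightarrow> 'a mpoly" where
  "linext b f = (\<Sum>m\<in>keys f. mconst (lookup f m) * b m)"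

lemma linext_add: "linext b (f + g) = linext b f + linext b g"
  unfolding linext_def
  by (rule setsum_keys_plus_distrib) (auto simp: mconst_add distrib_right)

lemma linext_0 [simp]: "linext b 0 = 0"
  by (simp add: linext_def)

lemma linext_sum: "linext b (sum g A) = (\<Sum>x\<in>A. linext b (g x))"
  by (induction A rule: infinite_finite_induct) (simp_all add: linext_add)

lemma linext_single [simp]: "linext b (single m a) = mconst a * b m"
  by (simp add: linext_def)

lemma linext_mconst_mult: "linext b (mconst a * f) = mconst a * linext b f"
proof -
  have "linext b (mconst a * f) = (\<Sum>m\<in>keys f. linext b (mconst a * single m (lookup f m)))"
    by (subst sum_single_lookup[of f, symmetric]) (simp only: sum_distrib_left linext_sum)
  also have "\<dots> = (\<Sum>m\<in>keys f. mconst a * (mconst (lookup f m) * b m))"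
    by (simp add: mconst_mult_single mconst_mult mult.assoc)
  finally show ?thesis
    by (simp only: linext_def sum_distrib_left)
qed

lemma linext_uminus: "linext b (- f) = - linext b f"
  by (metis add.inverse_inverse add.right_inverse add_eq_0_iff linext_0 linext_add)

lemma linext_diff: "linext b (f - g) = linext b f - linext b g"
  using linext_add[of b f "- g"] by (simp add: linext_uminus)

text \<open>The product is bilinear, so multiplicativity has to be checked on monomials
  only.\<close>

lemma linext_mult:
  assumes "\<And>m m'. b (m + m') = b m * b m'"
  shows "linext b (f * g) = linext b f * linext b g"
proof -
  have "linext b (f * g) =
      linext b ((\<Sum>m\<in>keys f. single m (lookup f m)) * (\<Sum>m\<in>keys g. single m (lookup g m)))"
    by (simp only: sum_single_lookup)
  also have "\<dots> = (\<Sum>m\<in>keys f. \<Sum>m'\<in>keys g.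
      (mconst (lookup f m) * b m) * (mconst (lookup g m') * b m'))"
    by (simp add: sum_product linext_sum mult_single mconst_mult assms mult_ac)
  finally show ?thesis
    by (simp only: linext_def sum_product)
qed

section \<open>Substitution, derivatives and divided differences\<close>

text \<open>Covers both the action of permutations and the passage to the coordinates
  \<open>y\<close>.\<close>

definition subst :: "(nat \<Rightarrow> 'a mpoly) \<Rightarrow> 'a::field mpoly \<Rightarrow> 'a mpoly" where
  "subst w = linext (\<lambda>m. \<Prod>i\<in>keys m. w i ^ lookup m i)"

lemma perm_act_eq_subst: "perm_act \<sigma> = subst (\<lambda>i. X (\<sigma> i))"
  by (simp add: fun_eq_iff perm_act_def subst_def linext_def)

lemma subst_add: "subst w (f + g) = subst w f + subst w g"
  and subst_0 [simp]: "subst w 0 = 0"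
  and subst_diff: "subst w (f - g) = subst w f - subst w g"
  and subst_sum: "subst w (sum h A) = (\<Sum>x\<in>A. subst w (h x))"
  by (simp_all add: subst_def linext_add linext_diff linext_sum)

lemma subst_mult: "subst w (f * g) = subst w f * subst w g"
  unfolding subst_def
proof (rule linext_mult)
  fix m m' :: "nat \<Rightarrow>\<^sub>0 nat"
  have keys: "keys (m + m') = keys m \<union> keys m'"
    by (auto simp: in_keys_iff lookup_add)
  have "(\<Prod>i\<in>keys p. w i ^ lookup p i) = (\<Prod>i\<in>keys m \<union> keys m'. w i ^ lookup p i)"
    if "keys p \<subseteq> keys m \<union> keys m'" for p
    using that by (intro prod.mono_neutral_left) (auto simp: in_keys_iff)
  then show "(\<Prod>i\<in>keys (m + m'). w i ^ lookup (m + m') i) =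
      (\<Prod>i\<in>keys m. w i ^ lookup m i) * (\<Prod>i\<in>keys m'. w i ^ lookup m' i)"
    by (simp add: keys lookup_add power_add prod.distrib)
qed

lemma subst_mconst [simp]: "subst w (mconst a) = mconst a"
  by (simp add: subst_def) (simp add: mconst_def)

lemma subst_X [simp]: "subst w (X i) = w i"
  by (simp add: subst_def X_def)

lemma subst_1 [simp]: "subst w 1 = 1"
  using subst_mconst[of w 1] by simp

lemma subst_power: "subst w (f ^ k) = subst w f ^ k"
  by (induction k) (simp_all add: subst_mult)

lemma subst_prod: "subst w (prod h A) = (\<Prod>x\<in>A. subst w (h x))"
  by (induction A rule: infinite_finite_induct) (simp_all add: subst_mult)

lemmas subst_simps = subst_add subst_diff subst_sum subst_mult subst_power subst_prod

lemma perm_act_mult: "perm_act \<sigma> (f * g) = perm_act \<sigma> f * perm_act \<sigma> g"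
  and perm_act_power: "perm_act \<sigma> (f ^ k) = perm_act \<sigma> f ^ k"
  and perm_act_sum: "perm_act \<sigma> (sum h A) = (\<Sum>x\<in>A. perm_act \<sigma> (h x))"
  and perm_act_mconst [simp]: "perm_act \<sigma> (mconst a) = mconst a"
  and perm_act_X [simp]: "perm_act \<sigma> (X i) = X (\<sigma> i)"
  and perm_act_0 [simp]: "perm_act \<sigma> 0 = 0"
  by (simp_all add: perm_act_eq_subst subst_simps)

lemma pderiv_var_eq_linext:
  "pderiv_var k = linext (\<lambda>m. single (m - single k 1) (of_nat (lookup m k)))"
  by (simp add: fun_eq_iff pderiv_var_def linext_def mconst_mult_single mult.commute)

lemma pderiv_var_mconst_mult: "pderiv_var k (mconst a * f) = mconst a * pderiv_var k f"
  and pderiv_var_sum: "pderiv_var k (sum h A) = (\<Sum>x\<in>A. pderiv_var k (h x))"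
  by (simp_all add: pderiv_var_eq_linext linext_mconst_mult linext_sum)

lemma pderiv_var_mconst [simp]: "pderiv_var k (mconst a) = 0"
  by (simp add: mconst_def pderiv_var_eq_linext)

lemma pderiv_var_0 [simp]: "pderiv_var k 0 = 0"
  using pderiv_var_mconst[of k 0] by simp

lemma pderiv_var_1 [simp]: "pderiv_var k 1 = 0"
  using pderiv_var_mconst[of k 1] by simp

lemma pderiv_var_X_mult: "pderiv_var k (X i * f) = (if i = k then f else 0) + X i * pderiv_var k f"
proof -
  have single: "pderiv_var k (X i * single m a) =
      (if i = k then single m a else 0) + X i * pderiv_var k (single m a)" for m and a :: 'a
  \<comment> \<open>If x_k does not occur in \<open>m\<close>, truncated subtraction leaves
    \<open>m\<close> unchanged, but the coefficient is 0; otherwise the subtraction is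
    exact.\<close>
  proof (cases "lookup m k = 0")
    case True
    have "i = k \<Longrightarrow> single i 1 + m - single k 1 = m"
      by simp
    with True show ?thesis
      by (auto simp: X_mult_single pderiv_var_eq_linext lookup_add lookup_single mconst_mult_single)
  next
    case False
    then have "single i 1 + m - single k 1 = single i 1 + (m - single k 1)"
      by (intro poly_mapping_eqI) (auto simp: lookup_add lookup_minus lookup_single when_def)
    moreover have "single i 1 + (m - single k 1) = m" if "i = k"
      using that False
      by (intro poly_mapping_eqI) (auto simp: lookup_add lookup_minus lookup_single when_def)
    ultimately show ?thesis
      by (auto simp: X_mult_single pderiv_var_eq_linext lookup_add lookup_single mconst_mult_single
          distrib_left distrib_right single_add mult.commute)
  qed
  have "pderiv_var k (X i * (\<Sum>m\<in>keys f. single m (lookup f m))) =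
     (if i = k then (\<Sum>m\<in>keys f. single m (lookup f m)) else 0) +
     X i * pderiv_var k (\<Sum>m\<in>keys f. single m (lookup f m))"
    by (simp add: sum_distrib_left pderiv_var_sum single sum.distrib)
  then show ?thesis
    by (simp only: sum_single_lookup)
qed

lemma pderiv_var_mult: "pderiv_var k (f * g) = pderiv_var k f * g + f * pderiv_var k g"
proof -
  show ?thesis
    by (rule mpoly_induct[of f UNIV])
       (simp_all add: pderiv_var_mconst_mult pderiv_var_X_mult pderiv_var_add ring_distribs mult.assoc
         add_ac)
qed

lemma pderiv_var_X: "pderiv_var k (X i) = (if i = k then 1 else 0)"
  using pderiv_var_X_mult[of k i 1] by simp

lemma divided_difference_eq:
  "k \<noteq> j \<Longrightarrow> (X k - X j) * divided_difference k j f = f - perm_act (transpose k j) f"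
  unfolding divided_difference_def by (rule theI'[OF divided_difference_ex1])

lemma divided_difference_unique:
  "k \<noteq> j \<Longrightarrow> (X k - X j) * q = f - perm_act (transpose k j) f \<Longrightarrow> divided_difference k j f = q"
  unfolding divided_difference_def by (rule the1_equality[OF divided_difference_ex1])

text \<open>With s the transposition, f g - (s f)(s g) = (f - s f)(s g) + f (g - s g). Division by
  x_k - x_j gives a Leibniz rule twisted by s.\<close>

lemma divided_difference_mult:
  assumes "k \<noteq> j"
  shows "divided_difference k j (f * g) =
    divided_difference k j f * perm_act (transpose k j) g + f * divided_difference k j g"
proof (rule divided_difference_unique[OF assms])
  let ?s = "perm_act (transpose k j)" and ?D = "divided_difference k j"
  have "(X k - X j) * (?D f * ?s g + f * ?D g) =
      ((X k - X j) * ?D f) * ?s g + f * ((X k - X j) * ?D g)"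
    by (simp only: distrib_left mult_ac)
  also have "\<dots> = f * g - ?s (f * g)"
    unfolding divided_difference_eq[OF assms] perm_act_mult by (simp add: algebra_simps)
  finally show "(X k - X j) * (?D f * ?s g + f * ?D g) = f * g - ?s (f * g)" .
qed

lemma divided_difference_mult_symmetric:
  assumes "k \<noteq> j" "perm_act (transpose k j) f = f"
  shows "divided_difference k j (f * g) = f * divided_difference k j g"
proof -
  have "divided_difference k j f = 0"
    using assms by (intro divided_difference_unique) auto
  with assms show ?thesis by (simp add: divided_difference_mult)
qed

lemma divided_difference_mconst [simp]: "k \<noteq> j \<Longrightarrow> divided_difference k j (mconst a) = 0"
  by (intro divided_difference_unique) simp_all

lemma divided_difference_X:
  assumes "k \<noteq> j"
  shows "divided_difference k j (X i) = (if i = k then 1 else if i = j then - 1 else 0)"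
  by (intro divided_difference_unique assms) (auto simp: transpose_def)

text \<open>A factor fixed by the transpositions involving k passes through the divided differences,
  so only the derivative sees it. This applies to constants and to s.\<close>

lemma dunkl_mult_symmetric:
  assumes "\<And>j. j \<in> {1..n} - {k} \<Longrightarrow> perm_act (transpose k j) f = f"
  shows "dunkl c n k (f * g) = pderiv_var k f * g + f * dunkl c n k g"
proof -
  have "(\<Sum>j\<in>{1..n} - {k}. divided_difference k j (f * g)) =
    f * (\<Sum>j\<in>{1..n} - {k}. divided_difference k j g)"
    unfolding sum_distrib_left
    by (rule sum.cong) (use assms in \<open>auto intro!: divided_difference_mult_symmetric\<close>)
  then show ?thesis
    unfolding dunkl_def pderiv_var_mult by (simp add: algebra_simps)
qed

lemma dunkl_mconst_mult: "dunkl c n k (mconst a * g) = mconst a * dunkl c n k g"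
  by (simp add: dunkl_mult_symmetric)

text \<open>Serves inductions that multiply by one variable: the extra terms are \<open>f\<close>
  and its images under transpositions.\<close>

lemma dunkl_X_mult:
  "dunkl c n k (X i * f) = (if i = k then f else 0) + X i * dunkl c n k f -
     mconst c * (\<Sum>j\<in>{1..n} - {k}. divided_difference k j (X i) * perm_act (transpose k j) f)"
proof -
  have "(\<Sum>j\<in>{1..n} - {k}. divided_difference k j (X i * f)) =
    (\<Sum>j\<in>{1..n} - {k}. divided_difference k j (X i) * perm_act (transpose k j) f) +
    X i * (\<Sum>j\<in>{1..n} - {k}. divided_difference k j f)"
    unfolding sum_distrib_left sum.distrib[symmetric]
    by (rule sum.cong) (auto intro!: divided_difference_mult)
  then show ?thesis
    unfolding dunkl_def pderiv_var_X_mult by (simp add: algebra_simps)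
qed

section \<open>Degrees\<close>

lemma mpolys_X: "i \<in> {1..n} \<Longrightarrow> X i \<in> mpolys n"
  by (auto simp: mpolys_def X_def)

lemma mpolys_single: "keys m \<subseteq> {1..n} \<Longrightarrow> single m a \<in> mpolys n"
  by (auto simp: mpolys_def)

lemma mpolys_diff: "f \<in> mpolys n \<Longrightarrow> g \<in> mpolys n \<Longrightarrow> f - g \<in> mpolys n"
  using mpolys_closed(4)[of f n "- g"] mpolys_closed(6)[of g n] by simp

lemma mpolys_sum: "(\<And>x. x \<in> A \<Longrightarrow> h x \<in> mpolys n) \<Longrightarrow> sum h A \<in> mpolys n"
  by (induction A rule: infinite_finite_induct) (simp_all add: mpolys_closed)

lemma mpolys_power: "f \<in> mpolys n \<Longrightarrow> f ^ k \<in> mpolys n"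
  by (induction k) (simp_all add: mpolys_closed)

lemma mpolys_prod: "(\<And>x. x \<in> A \<Longrightarrow> h x \<in> mpolys n) \<Longrightarrow> prod h A \<in> mpolys n"
  by (induction A rule: infinite_finite_induct) (simp_all add: mpolys_closed)

lemmas mpolys_intros = mpolys_closed mpolys_X mpolys_diff mpolys_sum mpolys_power mpolys_prod

lemma mdeg_superset: "finite A \<Longrightarrow> keys m \<subseteq> A \<Longrightarrow> mdeg m = (\<Sum>i\<in>A. lookup m i)"
  unfolding mdeg_def by (rule sum.mono_neutral_left) (auto simp: in_keys_iff)

lemma mdeg_add: "mdeg (m + m') = mdeg m + mdeg m'"
proof -
  have "keys (m + m') \<subseteq> keys m \<union> keys m'" by (rule keys_add)
  then show ?thesis
    by (simp add: mdeg_superset[of "keys m \<union> keys m'"] lookup_add sum.distrib)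
qed

lemma homogeneous_0 [simp]: "homogeneous d 0"
  and homogeneous_mconst [simp]: "homogeneous 0 (mconst a)"
  and homogeneous_X [simp]: "homogeneous 1 (X i)"
  by (simp_all add: homogeneous_def mconst_def X_def mdeg_def)

lemma homogeneous_1 [simp]: "homogeneous 0 1"
  using homogeneous_mconst[of 1] by simp

lemma homogeneous_add: "homogeneous d f \<Longrightarrow> homogeneous d g \<Longrightarrow> homogeneous d (f + g)"
  unfolding homogeneous_def using Poly_Mapping.keys_add[of f g] by blast

lemma homogeneous_mult:
  assumes "homogeneous d f" "homogeneous e g"
  shows "homogeneous (d + e) (f * g)"
  unfolding homogeneous_def
proof
  fix m assume "m \<in> keys (f * g)"
  then obtain a b where "m = a + b" "a \<in> keys f" "b \<in> keys g"
    using keys_mult[of f g] by blast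
  with assms show "mdeg m = d + e" by (auto simp: homogeneous_def mdeg_add)
qed

lemma homogeneous_mconst_mult: "homogeneous d f \<Longrightarrow> homogeneous d (mconst a * f)"
  using homogeneous_mult[OF homogeneous_mconst] by fastforce

lemma homogeneous_sum: "(\<And>x. x \<in> A \<Longrightarrow> homogeneous d (h x)) \<Longrightarrow> homogeneous d (sum h A)"
  by (induction A rule: infinite_finite_induct) (simp_all add: homogeneous_add)

lemma homogeneous_power: "homogeneous d f \<Longrightarrow> homogeneous (k * d) (f ^ k)"
  by (induction k) (auto intro: homogeneous_mult)

lemma homogeneous_prod:
  "(\<And>x. x \<in> A \<Longrightarrow> homogeneous (e x) (h x)) \<Longrightarrow> homogeneous (\<Sum>x\<in>A. e x) (prod h A)"
  by (induction A rule: infinite_finite_induct) (auto intro: homogeneous_mult)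

lemma hom_component_eq_linext:
  "hom_component d = linext (\<lambda>m. if mdeg m = d then single m 1 else 0)"
proof
  fix f :: "'a mpoly"
  show "hom_component d f = linext (\<lambda>m. if mdeg m = d then single m 1 else 0) f"
    unfolding hom_component_def linext_def
    by (simp add: sum.inter_filter if_distrib mconst_mult_single cong: if_cong)
qed

lemma hom_component_sum: "hom_component d (sum h A) = (\<Sum>x\<in>A. hom_component d (h x))"
  and hom_component_mconst_mult: "hom_component d (mconst a * f) = mconst a * hom_component d f"
  by (simp_all add: hom_component_eq_linext linext_sum linext_mconst_mult)

lemma hom_component_homogeneous:
  assumes "homogeneous e f"
  shows "hom_component d f = (if d = e then f else 0)"
proof -
  have *: "mdeg m = e" if "m \<in> keys f" for m
    using that assms by (simp add: homogeneous_def)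
  then have "{m. m \<in> keys f \<and> mdeg m = d} = (if d = e then keys f else {})"
    by auto
  then show ?thesis
    by (simp add: hom_component_def sum_single_lookup)
qed

lemma lookup_hom_component: "lookup (hom_component d f) m = (if mdeg m = d then lookup f m else 0)"
proof -
  have "lookup (hom_component d f) m = (\<Sum>k | k \<in> keys f \<and> mdeg k = d. if k = m then lookup f m else 0)"
    unfolding hom_component_def lookup_sum by (rule sum.cong) (auto simp: lookup_single)
  also have "\<dots> = (if mdeg m = d then lookup f m else 0)"
    by (subst sum.delta) (auto simp: in_keys_iff)
  finally show ?thesis .
qed

lemma keys_hom_component: "keys (hom_component d f) = {m \<in> keys f. mdeg m = d}"
  by (auto simp: in_keys_iff lookup_hom_component split: if_splits)

section \<open>Characteristic two\<close>

text \<open>Characteristic two passes from bit polynomials to fractions through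
  \<open>to_fract\<close>.\<close>

lemma F2c_add_self: "(a::F2c) + a = 0"
proof -
  have "(1::bit poly) + 1 = [:1 + 1:]" by (simp only: one_pCons add_pCons add_0_right)
  then have "(1::bit poly) + 1 = 0" by simp
  then have "to_fract ((1::bit poly) + 1) = 0" by simp
  then have "(1::F2c) + 1 = 0" by (simp only: to_fract_add to_fract_1)
  then show ?thesis by (metis distrib_left mult.right_neutral mult_zero_right)
qed

lemma mpoly_add_self [simp]: "(f::F2c mpoly) + f = 0"
  by (rule poly_mapping_eqI) (simp only: lookup_add F2c_add_self lookup_zero)

lemma mpoly_two_eq_0 [simp]: "(2::F2c mpoly) = 0"
  using mpoly_add_self[of 1] by (simp only: one_add_one)

lemma mpoly_add_self_left [simp]: "(f::F2c mpoly) + (f + g) = g"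
  by (simp flip: add.assoc)

lemma mpoly_minus_eq [simp]: "- (f::F2c mpoly) = f"
  by (simp add: neg_eq_iff_add_eq_0)

lemma mpoly_diff_eq_add: "(f::F2c mpoly) - g = f + g"
  by (simp add: diff_conv_add_uminus del: add_uminus_conv_diff)

lemma mpoly_of_nat: "(of_nat k :: F2c mpoly) = (if even k then 0 else 1)"
  by (induction k) auto

lemma mpoly_add_eq_0_iff: "(f::F2c mpoly) + g = 0 \<longleftrightarrow> f = g"
  by (metis add.right_neutral mpoly_add_self_left mpoly_add_self)

lemma mpoly_square_add: "((f::F2c mpoly) + g)\<^sup>2 = f\<^sup>2 + g\<^sup>2"
  by (simp add: power2_eq_square algebra_simps)

lemma mpoly_square_sum: "(sum h A)\<^sup>2 = (\<Sum>x\<in>A. (h x)\<^sup>2 :: F2c mpoly)"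
  by (induction A rule: infinite_finite_induct) (simp_all add: mpoly_square_add)

lemma pderiv_var_square: "pderiv_var k ((f::F2c mpoly)\<^sup>2) = 0"
  by (simp add: power2_eq_square pderiv_var_mult mult.commute)

text \<open>The coefficient e (e - 1) of a second derivative is even. This removes the terms linear
  in c that an unknown remainder would contribute to the final constant.\<close>

lemma pderiv_var_twice: "pderiv_var k (pderiv_var k (f::F2c mpoly)) = 0"
  by (rule mpoly_induct[of f UNIV]) (simp_all add: pderiv_var_X_mult pderiv_var_add)

section \<open>The polynomial ring as a structure\<close>

lemma ring_mpoly_ring: "ring (mpoly_ring n)"
  using cring_mpoly_ring by (rule cring.axioms)

lemma carrier_mpoly_ring [simp]: "carrier (mpoly_ring n) = mpolys n"
  and mult_mpoly_ring [simp]: "f \<otimes>\<^bsub>mpoly_ring n\<^esub> g = f * g"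
  and add_mpoly_ring [simp]: "f \<oplus>\<^bsub>mpoly_ring n\<^esub> g = f + g"
  and one_mpoly_ring [simp]: "\<one>\<^bsub>mpoly_ring n\<^esub> = 1"
  and zero_mpoly_ring [simp]: "\<zero>\<^bsub>mpoly_ring n\<^esub> = 0"
  by (simp_all add: mpoly_ring_def)

lemma a_inv_mpoly_ring: "f \<in> mpolys n \<Longrightarrow> \<ominus>\<^bsub>mpoly_ring n\<^esub> f = - f"
  by (rule abelian_group.minus_equality[OF ring.is_abelian_group[OF ring_mpoly_ring]])
     (auto simp: mpolys_closed)

text \<open>The image of this field in the quotient is the field of scalars for the dimensions in
  the Hilbert series.\<close>

lemma subfield_mconst: "subfield (range mconst) (mpoly_ring n :: 'a::field mpoly ring)"
proof -
  interpret cring "mpoly_ring n :: 'a mpoly ring" by (rule cring_mpoly_ring)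
  show ?thesis
  proof (rule subfieldI)
    show "subcring (range mconst) (mpoly_ring n :: 'a mpoly ring)"
    proof (intro subcringI' subringI)
      fix h :: "'a mpoly" assume "h \<in> range mconst"
      then obtain a where "h = mconst a" by auto
      moreover have "- mconst a = mconst (- a)" by (simp add: mconst_def single_uminus)
      ultimately show "\<ominus>\<^bsub>mpoly_ring n\<^esub> h \<in> range mconst"
        by (simp add: a_inv_mpoly_ring mpolys_closed)
    qed (auto simp: mpolys_closed simp flip: mconst_mult mconst_add mconst_1)
    have unit: "\<exists>g\<in>range mconst. g * f = 1 \<and> f * g = 1"
      if "f \<in> range mconst" "f \<noteq> 0" for f :: "'a mpoly"
    proof -
      from that obtain a where a: "f = mconst a" "a \<noteq> 0" by auto
      then have "mconst (inverse a) * f = 1" by (simp flip: mconst_mult)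
      then show ?thesis by (metis mult.commute rangeI)
    qed
    show "Units ((mpoly_ring n :: 'a mpoly ring)\<lparr>carrier := range mconst\<rparr>) =
        range mconst - {\<zero>\<^bsub>mpoly_ring n\<^esub>}"
      using unit by (auto simp: Units_def mpoly_ring_def)
  qed
qed

section \<open>Coordinates adapted to the relations\<close>

locale even_rank =
  fixes n :: nat
  assumes n_ge_2: "n \<ge> 2" and even_n: "even n"
begin

definition cc :: "F2c mpoly" where "cc = mconst cgen"

text \<open>
  For the coordinates \<open>w = y\<close> defined below, \<open>rel w\<close> lists \<open>x\<^sub>1\<^sup>4\<close> at 1, \<open>s\<^sup>2\<close> at \<open>n\<close> and \<open>z\<^sub>i\<^sup>2 + c s z\<^sub>i\<close> in
  between. The case \<open>w = X\<close> serves to prove injectivity, as \<open>Phi y\<close> is \<open>Phi X\<close> followed by the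
  substitution \<open>y\<close>, which is an involution.
\<close>

definition rdeg :: "nat \<Rightarrow> nat" where
  "rdeg i = (if i = 1 then 4 else 2)"

definition rel :: "(nat \<Rightarrow> F2c mpoly) \<Rightarrow> nat \<Rightarrow> F2c mpoly" where
  "rel w i = w i ^ rdeg i + (if i \<in> {2..<n} then cc * w n * w i else 0)"

text \<open>The power \<open>w i ^ e\<close> with each full block of \<open>rdeg i\<close> factors
  replaced by the relation whose leading term it is.\<close>

definition mixed_power :: "(nat \<Rightarrow> F2c mpoly) \<Rightarrow> nat \<Rightarrow> nat \<Rightarrow> F2c mpoly" where
  "mixed_power w i e = w i ^ (e mod rdeg i) * rel w i ^ (e div rdeg i)"

definition mixed_mon :: "(nat \<Rightarrow> F2c mpoly) \<Rightarrow> (nat \<Rightarrow>\<^sub>0 nat) \<Rightarrow> F2c mpoly" where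
  "mixed_mon w m = (\<Prod>i\<in>{1..n}. mixed_power w i (lookup m i))"

text \<open>Linear but not multiplicative in general; it makes the ideal of the relations correspond
  to a monomial ideal.\<close>

definition Phi :: "(nat \<Rightarrow> F2c mpoly) \<Rightarrow> F2c mpoly \<Rightarrow> F2c mpoly" where
  "Phi w = linext (mixed_mon w)"

lemma rdeg_pos: "rdeg i > 0"
  by (simp add: rdeg_def)

lemma mixed_power_0 [simp]: "mixed_power w i 0 = 1"
  by (simp add: mixed_power_def)

lemma mixed_power_rdeg_add: "mixed_power w i (rdeg i + e) = rel w i * mixed_power w i e"
  using rdeg_pos[of i] by (simp add: mixed_power_def mult_ac)

text \<open>A block is completed exactly when the remainder of \<open>e\<close> is
  \<open>rdeg i - 1\<close>; the leading power is then the relation plus its linear term in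
  \<open>w i\<close>. In the middle range \<open>rdeg i\<close> is 2, so this means odd
  \<open>e\<close>; at 1 and n there is no such term.\<close>

lemma mixed_power_Suc:
  "w i * mixed_power w i e =
     mixed_power w i (Suc e) + (if i \<in> {2..<n} \<and> odd e then cc * w n * mixed_power w i e else 0)"
proof (cases "Suc (e mod rdeg i) = rdeg i")
  case False
  then have "\<not> (i \<in> {2..<n} \<and> odd e)"
    by (auto simp: rdeg_def odd_iff_mod_2_eq_one)
  moreover from False have "Suc e mod rdeg i = Suc (e mod rdeg i)" "Suc e div rdeg i = e div rdeg i"
    by (simp_all add: mod_Suc div_Suc)
  ultimately show ?thesis
    by (simp only: mixed_power_def power_Suc) (simp add: mult_ac)
next
  case True
  then have Suc: "Suc e mod rdeg i = 0" "Suc e div rdeg i = Suc (e div rdeg i)"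
    by (simp_all add: mod_Suc div_Suc)
  have pow: "w i * w i ^ (e mod rdeg i) = w i ^ rdeg i"
    by (subst True[symmetric]) simp
  have odd: "odd e" if "i \<in> {2..<n}"
    using True that by (auto simp: rdeg_def odd_iff_mod_2_eq_one split: if_splits)
  have lin: "w i ^ (e mod rdeg i) = w i" if "i \<in> {2..<n}"
    using True that by (auto simp: rdeg_def split: if_splits)
  have "w i ^ rdeg i = rel w i + (if i \<in> {2..<n} then cc * w n * w i else 0)"
    by (simp add: rel_def add.assoc)
  then show ?thesis
    using odd lin
    by (simp add: mixed_power_def Suc mult.assoc[symmetric] pow distrib_right)
qed

text \<open>The shift \<open>e\<close> is left free because the values 0, 1 and
  \<open>rdeg i\<close> are all needed.\<close>

lemma mixed_mon_split:
  "i \<in> {1..n} \<Longrightarrow> mixed_mon w (single i e + m) =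
     mixed_power w i (e + lookup m i) * (\<Prod>j\<in>{1..n} - {i}. mixed_power w j (lookup m j))"
  by (auto simp: mixed_mon_def lookup_add lookup_single prod.remove[of _ i] intro!: prod.cong)

lemma rel_mult_mixed_mon:
  "i \<in> {1..n} \<Longrightarrow> rel w i * mixed_mon w m = mixed_mon w (single i (rdeg i) + m)"
  using mixed_mon_split[of i w 0 m] mixed_mon_split[of i w "rdeg i" m]
  by (simp add: mixed_power_rdeg_add mult.assoc)

lemma mixed_mon_n: "w n * mixed_mon w m = mixed_mon w (single n 1 + m)"
  using mixed_mon_split[of n w 0 m] mixed_mon_split[of n w 1 m] mixed_power_Suc[of w n "lookup m n"] n_ge_2
  by (simp add: mult.assoc[symmetric])

text \<open>Both terms on the right only raise an exponent of \<open>m\<close> by 1. Hence mixed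
  monomials over an upward closed set of exponents span an ideal.\<close>

lemma mult_mixed_mon:
  assumes "i \<in> {1..n}"
  shows "w i * mixed_mon w m = mixed_mon w (single i 1 + m) +
    (if i \<in> {2..<n} \<and> odd (lookup m i) then cc * mixed_mon w (single n 1 + m) else 0)"
proof -
  define P where "P = (\<Prod>j\<in>{1..n} - {i}. mixed_power w j (lookup m j))"
  have 0: "mixed_mon w m = mixed_power w i (lookup m i) * P"
    using mixed_mon_split[OF assms, of w 0 m] by (simp add: P_def)
  have 1: "mixed_mon w (single i 1 + m) = mixed_power w i (Suc (lookup m i)) * P"
    using mixed_mon_split[OF assms, of w 1 m] by (simp add: P_def)
  have "w i * mixed_mon w m = (w i * mixed_power w i (lookup m i)) * P"
    by (simp only: 0 mult.assoc)
  then show ?thesis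
    unfolding mixed_power_Suc 1 mixed_mon_n[symmetric] 0 by (simp add: distrib_right mult.assoc)
qed

lemma mixed_mon_0 [simp]: "mixed_mon w 0 = 1"
  by (simp add: mixed_mon_def)

text \<open>Multiplication by a relation becomes a shift of exponents, so questions about zero
  divisors reduce to monomials.\<close>

lemma rel_mult_Phi:
  assumes "i \<in> {1..n}"
  shows "rel w i * Phi w f = Phi w (single (single i (rdeg i)) 1 * f)"
proof -
  have "Phi w (single (single i (rdeg i)) 1 * f) =
      Phi w (\<Sum>m\<in>keys f. single (single i (rdeg i) + m) (lookup f m))"
    by (subst (1) sum_single_lookup[of f, symmetric]) (simp add: sum_distrib_left mult_single)
  also have "\<dots> = (\<Sum>m\<in>keys f. rel w i * (mconst (lookup f m) * mixed_mon w m))"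
    by (simp add: Phi_def linext_sum rel_mult_mixed_mon[OF assms, symmetric] mult_ac)
  finally show ?thesis
    by (simp add: Phi_def linext_def sum_distrib_left)
qed

subsection \<open>Triangularity\<close>

text \<open>In the weight that ignores \<open>x\<^sub>n\<close>, the term \<open>c x\<^sub>n x\<^sub>i\<close> of a relation is of lower order than \<open>x\<^sub>i\<^sup>2\<close>.\<close>

definition weight :: "(nat \<Rightarrow>\<^sub>0 nat) \<Rightarrow> nat" where
  "weight m = (\<Sum>i\<in>{1..<n}. lookup m i)"

definition below :: "nat \<Rightarrow> F2c mpoly set" where
  "below k = {r. \<forall>m\<in>keys r. weight m < k}"

lemma weight_add: "weight (m + m') = weight m + weight m'"
  by (simp add: weight_def lookup_add sum.distrib)

lemma weight_single: "weight (single i e) = (if i \<in> {1..<n} then e else 0)"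
  by (simp add: weight_def lookup_single when_def)

lemma below_add: "r \<in> below k \<Longrightarrow> r' \<in> below k \<Longrightarrow> r + r' \<in> below k"
  unfolding below_def using Poly_Mapping.keys_add[of r r'] by blast

lemma below_sum: "(\<And>x. x \<in> A \<Longrightarrow> h x \<in> below k) \<Longrightarrow> sum h A \<in> below k"
  by (induction A rule: infinite_finite_induct) (simp_all add: below_add, simp_all add: below_def)

lemma below_mult:
  assumes "\<And>m m'. m \<in> keys r \<Longrightarrow> m' \<in> keys r' \<Longrightarrow> weight m + weight m' < k"
  shows "r * r' \<in> below k"
  unfolding below_def
proof (intro CollectI ballI)
  fix m assume "m \<in> keys (r * r')"
  then obtain a b where "m = a + b" "a \<in> keys r" "b \<in> keys r'"
    using keys_mult[of r r'] by blast
  with assms show "weight m < k" by (auto simp: weight_add)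
qed

text \<open>In characteristic two the sum is the difference between \<open>p\<close> and the
  monomial, which must have smaller weight.\<close>

definition leads :: "(nat \<Rightarrow>\<^sub>0 nat) \<Rightarrow> F2c mpoly \<Rightarrow> bool" where
  "leads m p \<longleftrightarrow> p + single m 1 \<in> below (weight m)"

lemma leads_single: "leads m (single m 1)"
  by (simp add: leads_def below_def)

lemma leads_mult:
  assumes "leads m p" "leads m' p'"
  shows "leads (m + m') (p * p')"
proof -
  define r r' where "r = p + single m 1" and "r' = p' + single m' 1"
  have r: "r \<in> below (weight m)" "r' \<in> below (weight m')"
    using assms by (simp_all add: leads_def r_def r'_def)
  have "p * p' + single (m + m') 1 = single m 1 * r' + r * single m' 1 + r * r'"
    by (simp add: r_def r'_def algebra_simps mult_single)
  also have "\<dots> \<in> below (weight (m + m'))"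
    using r by (intro below_add below_mult) (auto simp: below_def weight_add add_strict_mono)
  finally show ?thesis by (simp add: leads_def)
qed

lemma leads_power: "leads (single i e) p \<Longrightarrow> leads (single i (k * e)) (p ^ k)"
proof (induction k)
  case 0
  then show ?case using leads_single[of 0] by simp
next
  case (Suc k)
  then show ?case using leads_mult[of "single i e" p "single i (k * e)" "p ^ k"]
    by (simp flip: single_add)
qed

lemma leads_mixed_power:
  assumes "i \<in> {1..n}"
  shows "leads (single i e) (mixed_power X i e)"
proof -
  have rel: "leads (single i (rdeg i)) (rel X i)"
  proof (cases "i \<in> {2..<n}")
    case True
    have "rel X i + single (single i (rdeg i)) 1 = cc * X n * X i"
      using True by (simp add: rel_def X_power add_ac)
    also have "cc * X n * X i = single (single n 1 + single i 1) cgen"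
      by (simp add: cc_def X_def mconst_def mult_single)
    also have "\<dots> \<in> below (weight (single i (rdeg i)))"
      using True n_ge_2
      by (auto simp: below_def weight_add weight_single rdeg_def)
    finally show ?thesis by (simp add: leads_def)
  next
    case False
    then show ?thesis by (auto simp: rel_def X_power leads_single)
  qed
  have "leads (single i (e mod rdeg i) + single i (e div rdeg i * rdeg i)) (mixed_power X i e)"
    unfolding mixed_power_def X_power by (intro leads_mult leads_power leads_single rel)
  then show ?thesis by (simp flip: single_add)
qed

lemma leads_mixed_mon:
  assumes "keys m \<subseteq> {1..n}"
  shows "leads m (mixed_mon X m)"
proof -
  have "leads (\<Sum>i\<in>A. single i (lookup m i)) (\<Prod>i\<in>A. mixed_power X i (lookup m i))"
    if "finite A" "A \<subseteq> {1..n}" for A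
    using that
  proof (induction A)
    case empty
    then show ?case using leads_single[of 0] by simp
  next
    case (insert i A)
    then show ?case by (auto intro!: leads_mult leads_mixed_power)
  qed
  from this[of "{1..n}"] have "leads (\<Sum>i\<in>{1..n}. single i (lookup m i)) (mixed_mon X m)"
    by (simp add: mixed_mon_def)
  moreover have "(\<Sum>i\<in>{1..n}. single i (lookup m i)) = (\<Sum>i\<in>keys m. single i (lookup m i))"
    using assms by (intro sum.mono_neutral_right) (auto simp: in_keys_iff)
  ultimately show ?thesis by (simp add: sum_single_lookup)
qed

text \<open>Each mixed monomial differs from its monomial by terms of lower weight, so
  \<open>Phi X f\<close> and \<open>f\<close> agree in the top weight of \<open>f\<close>. A zero
  image would leave \<open>f\<close> without its top terms.\<close>

lemma Phi_X_eq_0: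
  assumes "f \<in> mpolys n" "Phi X f = 0"
  shows "f = 0"
proof (rule ccontr)
  assume "f \<noteq> 0"
  define k where "k = Max (weight ` keys f)"
  have ne: "weight ` keys f \<noteq> {}" using \<open>f \<noteq> 0\<close> by simp
  have "Phi X f + f = (\<Sum>m\<in>keys f. mconst (lookup f m) * (mixed_mon X m + single m 1))"
    by (subst (2) sum_single_lookup[of f, symmetric])
       (simp add: Phi_def linext_def distrib_left sum.distrib mconst_mult_single)
  also have "\<dots> \<in> below k"
  proof (intro below_sum below_mult)
    fix m a b assume m: "m \<in> keys f" and a: "a \<in> keys (mconst (lookup f m))"
      and b: "b \<in> keys (mixed_mon X m + single m 1)"
    have "leads m (mixed_mon X m)"
      using m assms(1) by (intro leads_mixed_mon) (auto simp: mpolys_def)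
    then have "weight b < weight m" using b by (auto simp: leads_def below_def)
    moreover have "weight m \<le> k" unfolding k_def using m by (intro Max_ge) auto
    moreover have "a = 0" using a by (auto simp: mconst_def split: if_splits)
    ultimately show "weight a + weight b < k" by (simp add: weight_def)
  qed
  finally have "f \<in> below k" using assms(2) by simp
  moreover obtain m where "m \<in> keys f" "weight m = k"
    using Max_in[OF _ ne] by (auto simp: k_def)
  ultimately show False by (auto simp: below_def)
qed

subsection \<open>The bijection\<close>

definition y :: "nat \<Rightarrow> F2c mpoly" where
  "y i = (if i = n then \<Sum>j\<in>{1..n}. X j else if i \<in> {2..<n} then X i + X 1 else X i)"

lemma atLeastAtMost_split: "{1..n} = insert 1 (insert n {2..<n})"
  using n_ge_2 by auto

lemma sum_split: "(\<Sum>i\<in>{1..n}. h i) = h 1 + (h n + (\<Sum>i\<in>{2..<n}. h i))"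
  using n_ge_2 unfolding atLeastAtMost_split by (subst sum.insert; auto)+

lemma y_1 [simp]: "y (Suc 0) = X 1" and y_n: "y n = (\<Sum>j\<in>{1..n}. X j)"
  and y_mid: "i \<in> {2..<n} \<Longrightarrow> y i = X i + X 1"
  using n_ge_2 by (auto simp: y_def)

text \<open>The n - 2 copies of x_1 cancel because n is even, and of the remaining variables only
  x_n survives. Here the parity of n makes the \<open>y i\<close> coordinates.\<close>

lemma sum_y: "(\<Sum>i\<in>{1..n}. y i) = X n"
proof -
  have "(\<Sum>i\<in>{2..<n}. y i) = (\<Sum>i\<in>{2..<n}. X i + X 1)"
    by (rule sum.cong) (simp_all add: y_mid)
  also have "\<dots> = (\<Sum>i\<in>{2..<n}. X i)"
    using even_n n_ge_2 by (simp add: sum.distrib mpoly_of_nat)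
  finally have "(\<Sum>i\<in>{2..<n}. y i) = (\<Sum>i\<in>{2..<n}. X i)" .
  then show ?thesis
    unfolding sum_split y_n[unfolded sum_split] by (simp add: add_ac)
qed

lemma mpolys_y: "i \<in> {1..n} \<Longrightarrow> y i \<in> mpolys n"
  using n_ge_2 by (auto simp: y_def intro!: mpolys_intros)

lemma homogeneous_y: "homogeneous 1 (y i)"
  by (auto simp: y_def simp del: One_nat_def intro!: homogeneous_sum homogeneous_add)

text \<open>The same formula as in \<open>y_def\<close> with \<open>X\<close> and \<open>y\<close>
  exchanged; hence \<open>subst y\<close> is an involution.\<close>

lemma X_eq_y: "i \<in> {1..n} \<Longrightarrow>
    X i = (if i = n then \<Sum>j\<in>{1..n}. y j else if i \<in> {2..<n} then y i + y 1 else y i)"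
  using n_ge_2 unfolding sum_y by (cases "i = 1") (auto simp: y_mid add.assoc)

lemma subst_y_y: "i \<in> {1..n} \<Longrightarrow> subst y (y i) = X i"
  by (subst X_eq_y) (auto simp: y_def subst_add subst_sum)

lemma subst_y_y_eq: 
  assumes "f \<in> mpolys n"
  shows "subst y (subst y f) = f"
proof (rule mpoly_induct[of f "{1..n}"])
  show "keys m \<subseteq> {1..n}" if "m \<in> keys f" for m
    using that assms by (auto simp: mpolys_def)
qed (simp_all add: subst_add subst_mult subst_y_y)

lemma subst_y_Phi: "subst y (Phi X f) = Phi y f"
proof -
  have "subst y (rel X i) = rel y i" for i
    by (simp add: rel_def subst_simps cc_def)
  then show ?thesis
    by (simp add: Phi_def linext_def mixed_mon_def mixed_power_def subst_simps)
qed

lemma mpolys_rel: "i \<in> {1..n} \<Longrightarrow> rel y i \<in> mpolys n"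
  using n_ge_2 by (auto simp: rel_def cc_def intro!: mpolys_intros mpolys_y)

lemma mpolys_rel_X: "i \<in> {1..n} \<Longrightarrow> rel X i \<in> mpolys n"
  using n_ge_2 by (auto simp: rel_def cc_def intro!: mpolys_intros)

lemma mpolys_Phi_X: "Phi X f \<in> mpolys n" and mpolys_Phi: "Phi y f \<in> mpolys n"
  unfolding Phi_def linext_def mixed_mon_def mixed_power_def
  by (auto intro!: mpolys_intros mpolys_rel mpolys_y mpolys_rel_X)

lemma Phi_0 [simp]: "Phi w 0 = 0" and Phi_add: "Phi w (f + g) = Phi w f + Phi w g"
  and Phi_sum: "Phi w (sum h A) = (\<Sum>x\<in>A. Phi w (h x))"
  and Phi_mconst_mult: "Phi w (mconst a * f) = mconst a * Phi w f"
  and Phi_single: "Phi w (single m a) = mconst a * mixed_mon w m"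
  by (simp_all add: Phi_def linext_add linext_sum linext_mconst_mult)

lemma Phi_1 [simp]: "Phi w 1 = 1"
  using Phi_single[of w 0 1] by simp

lemma Phi_inj:
  assumes "f \<in> mpolys n" "g \<in> mpolys n" "Phi y f = Phi y g"
  shows "f = g"
proof -
  have "Phi y (f + g) = 0" using assms(3) by (simp add: Phi_add)
  then have "subst y (subst y (Phi X (f + g))) = 0" by (simp add: subst_y_Phi)
  then have "Phi X (f + g) = 0" by (simp add: subst_y_y_eq mpolys_Phi_X)
  then show ?thesis
    using Phi_X_eq_0[of "f + g"] assms by (simp add: mpolys_closed mpoly_add_eq_0_iff)
qed

section \<open>Spans of mixed monomials\<close>

definition supported :: "(nat \<Rightarrow>\<^sub>0 nat) set \<Rightarrow> F2c mpoly set" where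
  "supported U = {f \<in> mpolys n. keys f \<subseteq> U}"

lemma supported_0: "0 \<in> supported U"
  and supported_add: "f \<in> supported U \<Longrightarrow> g \<in> supported U \<Longrightarrow> f + g \<in> supported U"
  and supported_mconst_mult: "f \<in> supported U \<Longrightarrow> mconst a * f \<in> supported U"
  using Poly_Mapping.keys_add[of f g]
  by (auto simp: supported_def mpolys_closed in_keys_iff lookup_mconst_mult)

lemma supported_single: "m \<in> U \<Longrightarrow> keys m \<subseteq> {1..n} \<Longrightarrow> single m a \<in> supported U"
  by (auto simp: supported_def mpolys_single)

lemma Phi_supported_add:
  "p \<in> Phi w ` supported U \<Longrightarrow> q \<in> Phi w ` supported U \<Longrightarrow> p + q \<in> Phi w ` supported U"
  by (auto simp flip: Phi_add intro: supported_add)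

lemma Phi_supported_mconst_mult:
  "p \<in> Phi w ` supported U \<Longrightarrow> mconst a * p \<in> Phi w ` supported U"
  by (auto simp flip: Phi_mconst_mult intro: supported_mconst_mult)

lemma Phi_supported_0: "0 \<in> Phi w ` supported U"
  using supported_0[of U] by (force intro!: image_eqI[of _ _ 0])

lemma Phi_supported_sum:
  "(\<And>x. x \<in> A \<Longrightarrow> h x \<in> Phi w ` supported U) \<Longrightarrow> sum h A \<in> Phi w ` supported U"
  by (induction A rule: infinite_finite_induct) (simp_all add: Phi_supported_0 Phi_supported_add)

text \<open>By \<open>mult_mixed_mon\<close> a factor \<open>y i\<close> keeps exponents in the
  upward closed set \<open>U\<close>; each \<open>X i\<close> is a sum of such coordinates, and
  \<open>g\<close> is built from variables and constants.\<close>

lemma Phi_supported_mult: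
  assumes U: "\<And>i m. i \<in> {1..n} \<Longrightarrow> m \<in> U \<Longrightarrow> single i 1 + m \<in> U"
    and p: "p \<in> Phi y ` supported U" and g: "g \<in> mpolys n"
  shows "g * p \<in> Phi y ` supported U"
proof -
  have mon: "mixed_mon y m \<in> Phi y ` supported U" if "m \<in> U" "keys m \<subseteq> {1..n}" for m
    using supported_single[OF that, of 1] by (force simp: Phi_single intro!: image_eqI[of _ _ "single m 1"])
  have y: "y i * q \<in> Phi y ` supported U" if "i \<in> {1..n}" "q \<in> Phi y ` supported U" for i q
  proof -
    from that(2) obtain f where f: "f \<in> supported U" "q = Phi y f" by auto
    have "y i * q = (\<Sum>m\<in>keys f. mconst (lookup f m) * (y i * mixed_mon y m))"
      by (simp add: f(2) Phi_def linext_def sum_distrib_left mult_ac)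
    also have "\<dots> \<in> Phi y ` supported U"
    proof (intro Phi_supported_sum Phi_supported_mconst_mult)
      fix m assume "m \<in> keys f"
      then have m: "m \<in> U" "keys m \<subseteq> {1..n}" using f(1) by (auto simp: supported_def mpolys_def)
      have "mixed_mon y (single j 1 + m) \<in> Phi y ` supported U" if "j \<in> {1..n}" for j
        using m that U Poly_Mapping.keys_add[of "single j 1" m] by (intro mon) auto
      then show "y i * mixed_mon y m \<in> Phi y ` supported U"
        using n_ge_2 that(1)
        by (simp only: mult_mixed_mon cc_def)
           (auto intro!: Phi_supported_add Phi_supported_mconst_mult Phi_supported_0)
    qed
    finally show ?thesis .
  qed
  have X: "X i * q \<in> Phi y ` supported U" if "i \<in> {1..n}" "q \<in> Phi y ` supported U" for i q
    unfolding X_eq_y[OF that(1)] using that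
    by (auto simp: sum_distrib_right distrib_right simp del: y_1
        intro!: Phi_supported_add Phi_supported_sum y)
  show ?thesis
  proof (rule mpoly_induct[of g "{1..n}"])
    show "keys m \<subseteq> {1..n}" if "m \<in> keys g" for m
      using that g by (auto simp: mpolys_def)
  qed (use p in \<open>auto simp: distrib_right mult.assoc
        intro: Phi_supported_0 Phi_supported_mconst_mult X Phi_supported_add\<close>)
qed

text \<open>The set of all exponents is upward closed, so the image of \<open>Phi y\<close> is an
  ideal, and it contains 1.\<close>

lemma Phi_surj:
  assumes "f \<in> mpolys n"
  obtains h where "h \<in> mpolys n" "f = Phi y h"
proof -
  have "1 \<in> Phi y ` supported UNIV"
    by (rule image_eqI[of _ _ 1]) (simp_all add: supported_def mpolys_closed)
  from Phi_supported_mult[OF _ this assms] have "f \<in> Phi y ` supported UNIV" by simp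
  then show thesis using that by (auto simp: supported_def)
qed

section \<open>The complete intersection\<close>

text \<open>Exponents of the monomial ideal generated by the leading powers of the relations in
  \<open>S\<close>.\<close>

definition reducible :: "nat set \<Rightarrow> (nat \<Rightarrow>\<^sub>0 nat) set" where
  "reducible S = {m. \<exists>i\<in>S. rdeg i \<le> lookup m i}"

lemma Phi_reducible_ideal: "ideal (Phi y ` supported (reducible S)) (mpoly_ring n)"
proof -
  have "single i 1 + m \<in> reducible S" if "m \<in> reducible S" for i m
    using that by (force simp: reducible_def lookup_add)
  then show ?thesis
    unfolding ideal_mpoly_ring_iff
    by (auto simp: Phi_supported_0 mpolys_Phi intro!: Phi_supported_add Phi_supported_mult)
qed

lemma single_reducible: "i \<in> S \<Longrightarrow> single i (rdeg i) \<in> reducible S"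
  unfolding reducible_def by (auto intro: bexI[of _ i])

lemma rel_eq_Phi: "i \<in> {1..n} \<Longrightarrow> rel y i = Phi y (single (single i (rdeg i)) 1)"
  using rel_mult_Phi[of i y 1] by simp

text \<open>A mixed monomial with reducible exponent has a relation as a factor, by
  \<open>rel_mult_mixed_mon\<close>; conversely the right side is an ideal containing the
  relations.\<close>

lemma genideal_rel:
  assumes "S \<subseteq> {1..n}"
  shows "Idl\<^bsub>mpoly_ring n\<^esub> (rel y ` S) = Phi y ` supported (reducible S)"
proof
  interpret cring "mpoly_ring n :: F2c mpoly ring" by (rule cring_mpoly_ring)
  have rel: "rel y ` S \<subseteq> carrier (mpoly_ring n)"
    using assms mpolys_rel by auto
  have "rel y ` S \<subseteq> Phi y ` supported (reducible S)"
  proof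
    fix f assume "f \<in> rel y ` S"
    then obtain i where i: "i \<in> S" "f = rel y i" by auto
    then have "single (single i (rdeg i)) 1 \<in> supported (reducible S)"
      using assms by (intro supported_single single_reducible) auto
    then show "f \<in> Phi y ` supported (reducible S)"
      using i assms by (auto simp: rel_eq_Phi)
  qed
  then show "Idl\<^bsub>mpoly_ring n\<^esub> (rel y ` S) \<subseteq> Phi y ` supported (reducible S)"
    by (intro genideal_minimal Phi_reducible_ideal)
  let ?I = "Idl\<^bsub>mpoly_ring n\<^esub> (rel y ` S)"
  have "ideal ?I (mpoly_ring n)" by (rule genideal_ideal[OF rel])
  then have I: "0 \<in> ?I" "\<And>f g. f \<in> ?I \<Longrightarrow> g \<in> ?I \<Longrightarrow> f + g \<in> ?I"
    "\<And>f g. f \<in> ?I \<Longrightarrow> g \<in> mpolys n \<Longrightarrow> g * f \<in> ?I"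
    unfolding ideal_mpoly_ring_iff by auto
  have sum: "sum h A \<in> ?I" if "\<And>x. x \<in> A \<Longrightarrow> h x \<in> ?I" for h and A :: "(nat \<Rightarrow>\<^sub>0 nat) set"
    using that by (induction A rule: infinite_finite_induct) (auto intro: I)
  show "Phi y ` supported (reducible S) \<subseteq> ?I"
  proof
    fix p assume "p \<in> Phi y ` supported (reducible S)"
    then obtain f where f: "f \<in> supported (reducible S)" "p = Phi y f" by auto
    have "mconst (lookup f m) * mixed_mon y m \<in> ?I" if "m \<in> keys f" for m
    proof -
      from that f(1) have m: "keys m \<subseteq> {1..n}" "m \<in> reducible S"
        by (auto simp: supported_def mpolys_def)
      from m(2) obtain i where i: "i \<in> S" "rdeg i \<le> lookup m i" by (auto simp: reducible_def)
      define m' where "m' = m - single i (rdeg i)"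
      have "m = single i (rdeg i) + m'"
        unfolding m'_def using i(2)
        by (intro poly_mapping_eqI) (auto simp: lookup_add lookup_minus lookup_single when_def)
      then have "mixed_mon y m = rel y i * mixed_mon y m'"
        using i assms by (auto simp: rel_mult_mixed_mon)
      moreover have "mixed_mon y m' \<in> mpolys n"
        using mpolys_Phi[of "single m' 1"] by (simp add: Phi_single)
      moreover have "rel y i \<in> ?I" using genideal_self[OF rel] i by auto
      ultimately show ?thesis by (metis I(3) mpolys_closed(3) mult.commute)
    qed
    then show "p \<in> ?I"
      unfolding f(2) Phi_def linext_def by (rule sum)
  qed
qed

text \<open>Injectivity of \<open>Phi y\<close> allows ideal membership to be read off from
  exponents.\<close>

lemma Phi_in_reducible_iff:
  assumes "f \<in> mpolys n"
  shows "Phi y f \<in> Phi y ` supported (reducible S) \<longleftrightarrow> keys f \<subseteq> reducible S"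
  using assms Phi_inj[OF assms] by (auto simp: supported_def)

lemma one_not_in_Phi_reducible: "1 \<notin> Phi y ` supported (reducible S)"
  using Phi_in_reducible_iff[of 1 S] rdeg_pos by (auto simp: mpolys_closed reducible_def)

text \<open>Under \<open>Phi y\<close>, multiplication by the relation at j shifts only the exponent
  at j, whereas membership in the ideal of the earlier relations depends on exponents at other
  indices.\<close>

lemma regular_sequence_rel:
  assumes "distinct js" "set js \<subseteq> {1..n}"
  shows "regular_sequence (mpoly_ring n) (map (rel y) js)"
  unfolding regular_sequence_def
proof (intro conjI allI ballI impI)
  show "set (map (rel y) js) \<subseteq> carrier (mpoly_ring n)"
    using assms mpolys_rel by auto
  have "1 \<notin> Idl\<^bsub>mpoly_ring n\<^esub> (set (map (rel y) js))"
    using assms by (simp add: genideal_rel one_not_in_Phi_reducible)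
  then show "Idl\<^bsub>mpoly_ring n\<^esub> (set (map (rel y) js)) \<noteq> carrier (mpoly_ring n)"
    using mpolys_closed(2) by auto
next
  fix l and g :: "F2c mpoly"
  assume l: "l < length (map (rel y) js)" and g: "g \<in> carrier (mpoly_ring n)"
  define S where "S = set (take l js)"
  define j where "j = js ! l"
  have S: "S \<subseteq> {1..n}" using assms(2) set_take_subset[of l js] by (auto simp: S_def)
  have j: "j \<in> {1..n}" using assms(2) l nth_mem[of l js] by (auto simp: j_def simp del: nth_mem)
  have "j \<notin> S"
    using assms(1) l by (auto simp: S_def j_def in_set_conv_nth nth_eq_iff_index_eq)
  have Idl: "Idl\<^bsub>mpoly_ring n\<^esub> (set (take l (map (rel y) js))) = Phi y ` supported (reducible S)"
    using genideal_rel[OF S] by (simp add: S_def take_map)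
  obtain h where h: "h \<in> mpolys n" "g = Phi y h" using g Phi_surj by auto
  define h' where "h' = single (single j (rdeg j)) 1 * h"
  have h': "h' \<in> mpolys n" using h(1) j by (auto simp: h'_def intro!: mpolys_closed mpolys_single split: if_splits)
  assume "map (rel y) js ! l \<otimes>\<^bsub>mpoly_ring n\<^esub> g \<in> Idl\<^bsub>mpoly_ring n\<^esub> (set (take l (map (rel y) js)))"
  then have "Phi y h' \<in> Phi y ` supported (reducible S)"
    using l j by (simp add: Idl h(2) rel_mult_Phi h'_def flip: j_def)
  then have sub: "keys h' \<subseteq> reducible S" using Phi_in_reducible_iff[OF h'] by simp
  have "keys h \<subseteq> reducible S"
  proof
    fix m assume "m \<in> keys h"
    have "lookup h' (single j (rdeg j) + m) = lookup h m"
    proof -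
      have "h' = (\<Sum>k\<in>keys h. single (single j (rdeg j) + k) (lookup h k))"
        unfolding h'_def
        by (subst (1) sum_single_lookup[of h, symmetric]) (simp add: sum_distrib_left mult_single)
      then have "lookup h' (single j (rdeg j) + m) = (\<Sum>k\<in>keys h. if k = m then lookup h m else 0)"
        by (auto simp: lookup_sum lookup_single when_def intro!: sum.cong)
      with \<open>m \<in> keys h\<close> show ?thesis by simp
    qed
    with \<open>m \<in> keys h\<close> have "single j (rdeg j) + m \<in> keys h'" by (simp add: in_keys_iff)
    with sub obtain i where "i \<in> S" "rdeg i \<le> lookup (single j (rdeg j) + m) i"
      by (auto simp: reducible_def)
    with \<open>j \<notin> S\<close> show "m \<in> reducible S"
      by (auto simp: reducible_def lookup_add lookup_single when_def intro!: bexI[of _ i] split: if_splits)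
  qed
  then show "g \<in> Idl\<^bsub>mpoly_ring n\<^esub> (set (take l (map (rel y) js)))"
    using Phi_in_reducible_iff[OF h(1)] by (simp add: Idl h(2))
qed

section \<open>Compatibility with the grading\<close>

lemma homogeneous_rel: "homogeneous (rdeg i) (rel y i)"
proof -
  have "homogeneous (rdeg i) (y i ^ rdeg i)"
    using homogeneous_power[OF homogeneous_y, of "rdeg i" i] by simp
  moreover have "homogeneous 2 (cc * y n * y i)"
    using homogeneous_mult[OF homogeneous_mconst_mult[OF homogeneous_y, of cgen n] homogeneous_y, of i]
    by (simp add: cc_def numeral_2_eq_2)
  ultimately show ?thesis
    by (auto simp: rel_def rdeg_def intro: homogeneous_add)
qed

lemma homogeneous_mixed_mon:
  assumes "keys m \<subseteq> {1..n}"
  shows "homogeneous (mdeg m) (mixed_mon y m)"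
proof -
  have "homogeneous e (mixed_power y i e)" for i e
  proof -
    have "homogeneous (e mod rdeg i * 1 + e div rdeg i * rdeg i) (mixed_power y i e)"
      unfolding mixed_power_def
      by (intro homogeneous_mult homogeneous_power homogeneous_y homogeneous_rel)
    then show ?thesis by simp
  qed
  then show ?thesis
    using assms unfolding mixed_mon_def by (auto simp: mdeg_superset[of "{1..n}"] intro: homogeneous_prod)
qed

lemma hom_component_Phi:
  assumes "f \<in> mpolys n"
  shows "hom_component d (Phi y f) = Phi y (hom_component d f)"
proof -
  have "hom_component d (Phi y f) = (\<Sum>m\<in>keys f. mconst (lookup f m) * hom_component d (mixed_mon y m))"
    by (simp add: Phi_def linext_def hom_component_sum hom_component_mconst_mult)
  also have "\<dots> = (\<Sum>m\<in>keys f. mconst (lookup f m) * (if mdeg m = d then mixed_mon y m else 0))"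
    using assms by (intro sum.cong refl arg_cong2[of _ _ _ _ "(*)"])
      (auto simp: mpolys_def hom_component_homogeneous[OF homogeneous_mixed_mon])
  also have "\<dots> = Phi y (hom_component d f)"
    by (simp add: hom_component_eq_linext linext_def Phi_sum Phi_mconst_mult Phi_single if_distrib cong: if_cong)
  finally show ?thesis .
qed

section \<open>The ideal \<open>J\<close> and normal forms modulo it\<close>

definition J :: "F2c mpoly set" where
  "J = Phi y ` supported (reducible {1..n})"

text \<open>These exponents index a basis of the quotient by \<open>J\<close>.\<close>

definition standard :: "(nat \<Rightarrow>\<^sub>0 nat) set" where
  "standard = {m. keys m \<subseteq> {1..n} \<and> m \<notin> reducible {1..n}}"

lemma ideal_J: "ideal J (mpoly_ring n)"
  unfolding J_def by (rule Phi_reducible_ideal)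

lemma one_not_in_J: "1 \<notin> J"
  unfolding J_def by (rule one_not_in_Phi_reducible)

lemma J_props: "J \<subseteq> mpolys n" "0 \<in> J" "f \<in> J \<Longrightarrow> g \<in> J \<Longrightarrow> f + g \<in> J"
  "f \<in> J \<Longrightarrow> g \<in> mpolys n \<Longrightarrow> g * f \<in> J"
  using ideal_J unfolding ideal_mpoly_ring_iff by auto

lemma J_sum: "(\<And>x. x \<in> A \<Longrightarrow> h x \<in> J) \<Longrightarrow> sum h A \<in> J"
  by (induction A rule: infinite_finite_induct) (simp_all add: J_props)

lemma supported_hom_component: "f \<in> supported U \<Longrightarrow> hom_component d f \<in> supported U"
  by (auto simp: supported_def mpolys_def keys_hom_component)

lemma hom_component_J:
  assumes "f \<in> J"
  shows "hom_component d f \<in> J"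
proof -
  obtain h where h: "h \<in> supported (reducible {1..n})" "f = Phi y h"
    using assms by (auto simp: J_def)
  moreover from h have "h \<in> mpolys n" by (simp add: supported_def)
  ultimately show ?thesis
    by (auto simp: J_def hom_component_Phi intro: supported_hom_component)
qed

lemma rel_in_J: "i \<in> {1..n} \<Longrightarrow> rel y i \<in> J"
  unfolding J_def rel_eq_Phi
  by (intro imageI supported_single single_reducible) auto

lemma Phi_standard_in_J: "f \<in> supported standard \<Longrightarrow> Phi y f \<in> J \<longleftrightarrow> f = 0"
  unfolding J_def using Phi_in_reducible_iff[of f "{1..n}"]
  by (auto simp: supported_def standard_def simp flip: keys_eq_empty)

text \<open>The terms of the preimage under \<open>Phi y\<close> are split into standard and
  reducible ones, and the latter map into \<open>J\<close>. Degrees survive because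
  \<open>Phi y\<close> is injective and commutes with homogeneous components.\<close>

lemma standard_rep:
  assumes "f \<in> mpolys n"
  obtains h where "h \<in> supported standard" "f + Phi y h \<in> J"
    "\<And>d. homogeneous d f \<Longrightarrow> homogeneous d h"
proof -
  obtain g where g: "g \<in> mpolys n" "f = Phi y g" using Phi_surj[OF assms] .
  define part where "part A = (\<Sum>m\<in>keys g \<inter> A. single m (lookup g m))" for A
  have lookup_part: "lookup (part A) m = (if m \<in> A then lookup g m else 0)" for A m
  proof -
    have "lookup (part A) m = (\<Sum>k\<in>keys g \<inter> A. if k = m then lookup g m else 0)"
      unfolding part_def lookup_sum by (rule sum.cong) (auto simp: lookup_single)
    then show ?thesis by (auto simp: in_keys_iff)
  qed
  have keys_part: "keys (part A) = keys g \<inter> A" for A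
    by (auto simp: in_keys_iff lookup_part split: if_splits)
  have supp: "part A \<in> supported A" for A
    using g(1) by (auto simp: supported_def keys_part mpolys_def)
  have "g = part standard + part (reducible {1..n})"
  proof (rule poly_mapping_eqI)
    fix m
    show "lookup g m = lookup (part standard + part (reducible {1..n})) m"
      using g(1) by (cases "m \<in> keys g") (auto simp: lookup_add lookup_part standard_def mpolys_def in_keys_iff)
  qed
  then have "f + Phi y (part standard) = Phi y (part (reducible {1..n}))"
    by (simp add: g(2) Phi_add algebra_simps)
  then have "f + Phi y (part standard) \<in> J"
    using supp by (auto simp: J_def)
  moreover have "homogeneous d (part standard)" if "homogeneous d f" for d
  proof -
    have "Phi y (hom_component d g) = Phi y g"
      using that hom_component_homogeneous[OF that, of d] g by (simp add: hom_component_Phi)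
    moreover have "hom_component d g \<in> mpolys n"
      using g(1) by (auto simp: mpolys_def keys_hom_component)
    ultimately have "hom_component d g = g" using Phi_inj g(1) by blast
    then have "mdeg m = d" if "m \<in> keys g" for m
      using that by (metis in_keys_iff lookup_hom_component)
    then show ?thesis by (simp add: homogeneous_def keys_part)
  qed
  ultimately show thesis using that supp by blast
qed

section \<open>The Hilbert series\<close>

abbreviation R :: "F2c mpoly ring" where "R \<equiv> mpoly_ring n"

definition cls :: "F2c mpoly \<Rightarrow> F2c mpoly set" where
  "cls f = J +>\<^bsub>R\<^esub> f"

definition monomials :: "nat \<Rightarrow> (nat \<Rightarrow>\<^sub>0 nat) set" where
  "monomials d = {m \<in> standard. mdeg m = d}"

lemma cls_hom: "ring_hom_ring R (R Quot J) cls"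
  using ideal.rcos_ring_hom_ring[OF ideal_J] by (simp add: cls_def[abs_def])

lemma cls_eq_iff:
  assumes "f \<in> mpolys n" "g \<in> mpolys n"
  shows "cls f = cls g \<longleftrightarrow> f + g \<in> J"
  using ring.quotient_eq_iff_same_a_r_cos[OF ring_mpoly_ring ideal_J, of f g] assms
  by (simp add: cls_def a_minus_def a_inv_mpoly_ring)

lemma cls_add: "f \<in> mpolys n \<Longrightarrow> g \<in> mpolys n \<Longrightarrow> cls (f + g) = cls f \<oplus>\<^bsub>R Quot J\<^esub> cls g"
  and cls_mult: "f \<in> mpolys n \<Longrightarrow> g \<in> mpolys n \<Longrightarrow> cls (f * g) = cls f \<otimes>\<^bsub>R Quot J\<^esub> cls g"
  and cls_0: "cls 0 = \<zero>\<^bsub>R Quot J\<^esub>" and cls_1: "cls 1 = \<one>\<^bsub>R Quot J\<^esub>"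
  and cls_closed: "f \<in> mpolys n \<Longrightarrow> cls f \<in> carrier (R Quot J)"
proof -
  interpret ring_hom_ring R "R Quot J" cls by (rule cls_hom)
  show "f \<in> mpolys n \<Longrightarrow> g \<in> mpolys n \<Longrightarrow> cls (f + g) = cls f \<oplus>\<^bsub>R Quot J\<^esub> cls g"
    "f \<in> mpolys n \<Longrightarrow> g \<in> mpolys n \<Longrightarrow> cls (f * g) = cls f \<otimes>\<^bsub>R Quot J\<^esub> cls g"
    "cls 0 = \<zero>\<^bsub>R Quot J\<^esub>" "cls 1 = \<one>\<^bsub>R Quot J\<^esub>"
    "f \<in> mpolys n \<Longrightarrow> cls f \<in> carrier (R Quot J)"
    using hom_add[of f g] hom_mult[of f g] hom_zero hom_one hom_closed[of f] by simp_all
qed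

lemma subfield_cls_mconst: "subfield (cls ` range mconst) (R Quot J)"
proof (rule ring_hom_ring.img_is_subfield(2)[OF cls_hom subfield_mconst])
  show "\<one>\<^bsub>R Quot J\<^esub> \<noteq> \<zero>\<^bsub>R Quot J\<^esub>"
    using cls_eq_iff[of 1 0] one_not_in_J by (simp add: mpolys_closed cls_0 cls_1)
qed

text \<open>Each standard monomial adjoins a line: by \<open>Phi_standard_in_J\<close> its class is
  not in the span of the previous ones.\<close>

lemma dimension_supported:
  assumes "finite A" "A \<subseteq> standard"
  shows "ring.dimension (R Quot J) (card A) (cls ` range mconst) ((\<lambda>f. cls (Phi y f)) ` supported A)"
  using assms
proof (induction A)
  interpret ring "R Quot J" by (rule ideal.quotient_is_ring[OF ideal_J])
  case empty
  have "supported {} = {0}" by (auto simp: supported_def mpolys_closed)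
  then show ?case by (simp add: cls_0)
next
  interpret ring "R Quot J" by (rule ideal.quotient_is_ring[OF ideal_J])
  case (insert m A)
  let ?K = "cls ` range mconst" and ?E = "\<lambda>A. (\<lambda>f. cls (Phi y f)) ` supported A"
  have m: "keys m \<subseteq> {1..n}" using insert.prems by (auto simp: standard_def)
  have mono: "A \<subseteq> B \<Longrightarrow> supported A \<subseteq> supported B" for A B by (auto simp: supported_def)
  define v where "v = Phi y (single m 1)"
  have v: "v \<in> mpolys n" by (simp add: v_def mpolys_Phi)
  have "cls v \<notin> ?E A"
  proof
    assume "cls v \<in> ?E A"
    then obtain f where f: "f \<in> supported A" "cls v = cls (Phi y f)" by auto
    then have "Phi y (single m 1 + f) \<in> J"
      using v by (simp add: cls_eq_iff mpolys_Phi Phi_add v_def)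
    moreover have "single m 1 + f \<in> supported standard"
      using insert.prems f(1) m mono[of A standard]
      by (intro supported_add supported_single) auto
    ultimately have "f = single m 1"
      using Phi_standard_in_J[of "single m 1 + f"] by (simp add: mpoly_add_eq_0_iff)
    with f(1) insert.hyps show False by (auto simp: supported_def)
  qed
  moreover have "?E (insert m A) = line_extension ?K (cls v) (?E A)"
  proof (intro equalityI subsetI)
    fix q assume "q \<in> ?E (insert m A)"
    then obtain f where f: "f \<in> supported (insert m A)" "q = cls (Phi y f)" by auto
    \<comment> \<open>In characteristic two this addition deletes the term of \<open>f\<close> at
      \<open>m\<close>.\<close>
    define g where "g = f + single m (lookup f m)"
    have "m \<notin> keys g"
      by (simp add: in_keys_iff g_def lookup_add F2c_add_self)
    moreover have "g \<in> supported (insert m A)"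
      unfolding g_def using f(1) m by (intro supported_add supported_single) auto
    ultimately have g: "g \<in> supported A" by (auto simp: supported_def)
    have "f = mconst (lookup f m) * single m 1 + g"
      by (simp add: g_def mconst_mult_single add.left_commute)
    then have "Phi y f = mconst (lookup f m) * v + Phi y g"
      unfolding v_def Phi_mconst_mult[symmetric] Phi_add[symmetric] by simp
    then have "q = cls (mconst (lookup f m)) \<otimes>\<^bsub>R Quot J\<^esub> cls v \<oplus>\<^bsub>R Quot J\<^esub> cls (Phi y g)"
      using v by (simp add: f(2) cls_add cls_mult mpolys_closed mpolys_Phi)
    with g show "q \<in> line_extension ?K (cls v) (?E A)"
      unfolding line_extension_mem_iff by blast
  next
    fix q assume "q \<in> line_extension ?K (cls v) (?E A)"
    then obtain a g where g: "g \<in> supported A"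
      "q = cls (mconst a) \<otimes>\<^bsub>R Quot J\<^esub> cls v \<oplus>\<^bsub>R Quot J\<^esub> cls (Phi y g)"
      unfolding line_extension_mem_iff by blast
    have "q = cls (mconst a * v + Phi y g)"
      using v by (simp add: g(2) cls_add cls_mult mpolys_closed mpolys_Phi)
    also have "mconst a * v + Phi y g = Phi y (mconst a * single m 1 + g)"
      by (simp add: v_def Phi_mconst_mult Phi_add)
    finally have "q = cls (Phi y (mconst a * single m 1 + g))" .
    moreover have "mconst a * single m 1 + g \<in> supported (insert m A)"
      using g(1) m mono[of A "insert m A"]
      by (intro supported_add supported_mconst_mult supported_single) auto
    ultimately show "q \<in> ?E (insert m A)" by blast
  qed
  moreover have "dimension (card A) ?K (?E A)"
    using insert by auto
  ultimately show ?case
    using insert.hyps Suc_dim[OF cls_closed[OF v], of "?E A" "card A" ?K] by simp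
qed

section \<open>Counting standard monomials\<close>

lemma standard_iff: "m \<in> standard \<longleftrightarrow> keys m \<subseteq> {1..n} \<and> (\<forall>i\<in>{1..n}. lookup m i < rdeg i)"
  by (auto simp: standard_def reducible_def not_le)

text \<open>Restriction makes exponent vectors extensional, so that they form the index set of an
  expanded product of sums.\<close>

lemma bij_betw_standard:
  "bij_betw (\<lambda>m. restrict (lookup m) {1..n}) (monomials d)
     {g \<in> PiE {1..n} (\<lambda>i. {..<rdeg i}). (\<Sum>i\<in>{1..n}. g i) = d}"
proof (rule bij_betwI[where g = "\<lambda>g. \<Sum>i\<in>{1..n}. single i (g i)"])
  have lookup: "lookup (\<Sum>i = Suc 0..n. single i (g i)) j = (if j \<in> {Suc 0..n} then g j else 0)"
    for g j
    by (simp add: lookup_sum lookup_single when_def)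
  show "(\<lambda>m. restrict (lookup m) {1..n}) \<in> monomials d \<rightarrow>
      {g \<in> PiE {1..n} (\<lambda>i. {..<rdeg i}). (\<Sum>i\<in>{1..n}. g i) = d}"
    by (auto simp: monomials_def standard_iff mdeg_superset[of "{1..n}"])
  show "(\<lambda>g. \<Sum>i\<in>{1..n}. single i (g i)) \<in>
      {g \<in> PiE {1..n} (\<lambda>i. {..<rdeg i}). (\<Sum>i\<in>{1..n}. g i) = d} \<rightarrow> monomials d"
  proof
    fix g assume g: "g \<in> {g \<in> PiE {1..n} (\<lambda>i. {..<rdeg i}). (\<Sum>i\<in>{1..n}. g i) = d}"
    have "keys (\<Sum>i\<in>{1..n}. single i (g i)) \<subseteq> {1..n}"
      by (auto simp: in_keys_iff lookup simp del: atLeastAtMost_iff split: if_splits)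
    then show "(\<Sum>i\<in>{1..n}. single i (g i)) \<in> monomials d"
      using g by (auto simp: monomials_def standard_iff mdeg_superset[of "{1..n}"] lookup PiE_iff)
  qed
next
  fix m assume "m \<in> monomials d"
  then have "keys m \<subseteq> {1..n}" by (simp add: monomials_def standard_iff)
  then show "(\<Sum>i\<in>{1..n}. single i (restrict (lookup m) {1..n} i)) = m"
    by (intro poly_mapping_eqI) (auto simp: lookup_sum lookup_single when_def in_keys_iff)
next
  fix g assume "g \<in> {g \<in> PiE {1..n} (\<lambda>i. {..<rdeg i}). (\<Sum>i\<in>{1..n}. g i) = d}"
  then show "restrict (lookup (\<Sum>i\<in>{1..n}. single i (g i))) {1..n} = g"
    by (auto simp: lookup_sum lookup_single when_def PiE_def extensional_def fun_eq_iff)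
qed

lemma finite_monomials: "finite (monomials d)"
  unfolding bij_betw_finite[OF bij_betw_standard]
  by (rule finite_subset[of _ "PiE {1..n} (\<lambda>i. {..<rdeg i})"]) (auto intro: finite_PiE)

text \<open>The count is a coefficient of the product of the sums 1 + ... + t^(rdeg i - 1). The
  factor at 1 is 1 + t + t^2 + t^3 = (1 + t)(1 + t^2), and the other n - 1 factors are 1 +
  t.\<close>

lemma card_monomials:
  "int (card (monomials d)) = fps_nth ((1 + fps_X) ^ n * (1 + fps_X ^ 2)) d"
proof -
  let ?P = "PiE {1..n} (\<lambda>i. {..<rdeg i})"
  have fin: "finite ?P" by (intro finite_PiE) auto
  let ?F = "\<Prod>i\<in>{1..n}. \<Sum>e<rdeg i. fps_X ^ e :: int fps"
  have "?F = (\<Sum>g\<in>?P. fps_X ^ (\<Sum>i\<in>{1..n}. g i))"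
    by (subst prod_sum_PiE) (simp_all add: power_sum)
  then have "fps_nth ?F d = (\<Sum>g\<in>?P. if (\<Sum>i\<in>{1..n}. g i) = d then 1 else 0)"
    by (simp only: fps_sum_nth) (auto simp: fps_X_power_nth intro!: sum.cong)
  also have "\<dots> = int (card {g \<in> ?P. (\<Sum>i\<in>{1..n}. g i) = d})"
    using fin by (simp add: sum.If_cases Int_def)
  also have "\<dots> = int (card (monomials d))"
    using bij_betw_same_card[OF bij_betw_standard] by simp
  finally have "int (card (monomials d)) = fps_nth ?F d"
    by simp
  also have "?F =
      (\<Sum>e<rdeg 1. fps_X ^ e) * ((\<Sum>e<rdeg n. fps_X ^ e) * (\<Prod>i\<in>{2..<n}. \<Sum>e<rdeg i. fps_X ^ e))"
    using n_ge_2 unfolding atLeastAtMost_split by (subst prod.insert; auto)+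
  also have "(\<Prod>i\<in>{2..<n}. \<Sum>e<rdeg i. fps_X ^ e) = (\<Prod>i\<in>{2..<n}. 1 + fps_X :: int fps)"
    by (rule prod.cong) (auto simp: rdeg_def numeral_2_eq_2)
  also have "(\<Sum>e<rdeg n. fps_X ^ e) = (1 + fps_X :: int fps)"
    using n_ge_2 by (auto simp: rdeg_def numeral_2_eq_2)
  also have "(\<Sum>e<rdeg 1. fps_X ^ e) = ((1 + fps_X) * (1 + fps_X ^ 2) :: int fps)"
    by (simp add: rdeg_def eval_nat_numeral algebra_simps)
  also have "(1 + fps_X) * (1 + fps_X ^ 2) * ((1 + fps_X) * (\<Prod>i\<in>{2..<n}. 1 + fps_X :: int fps)) =
      (1 + fps_X) ^ (Suc (Suc (n - 2))) * (1 + fps_X ^ 2)"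
    by (simp add: mult_ac)
  also have "Suc (Suc (n - 2)) = n" using n_ge_2 by simp
  finally show ?thesis .
qed

text \<open>Normal forms keep the degree, so each graded part is spanned by the standard monomials
  of that degree.\<close>

lemma cls_homogeneous:
  "cls ` {f \<in> mpolys n. homogeneous d f} = (\<lambda>f. cls (Phi y f)) ` supported (monomials d)"
proof (intro equalityI subsetI)
  fix q assume "q \<in> cls ` {f \<in> mpolys n. homogeneous d f}"
  then obtain f where f: "f \<in> mpolys n" "homogeneous d f" "q = cls f" by auto
  obtain h where h: "h \<in> supported standard" "f + Phi y h \<in> J" "homogeneous d h"
    using standard_rep[OF f(1)] f(2) by metis
  then have "q = cls (Phi y h)" using f by (simp add: cls_eq_iff mpolys_Phi)
  moreover have "h \<in> supported (monomials d)"
    using h by (auto simp: supported_def monomials_def homogeneous_def)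
  ultimately show "q \<in> (\<lambda>f. cls (Phi y f)) ` supported (monomials d)" by blast
next
  fix q assume "q \<in> (\<lambda>f. cls (Phi y f)) ` supported (monomials d)"
  then obtain f where f: "f \<in> supported (monomials d)" "q = cls (Phi y f)" by auto
  have "homogeneous d (mconst (lookup f m) * mixed_mon y m)" if "m \<in> keys f" for m
    using f(1) that homogeneous_mixed_mon[of m]
    by (auto simp: supported_def monomials_def standard_def intro!: homogeneous_mconst_mult)
  then have "homogeneous d (Phi y f)"
    by (auto simp: Phi_def linext_def intro: homogeneous_sum)
  then show "q \<in> cls ` {f \<in> mpolys n. homogeneous d f}"
    using f by (auto simp: mpolys_Phi)
qed

lemma hilbert_series_if_Jmax_eq:
  assumes "Jmax cgen n = J"
  shows "hilbert_series_L cgen n = (1 + fps_X) ^ n * (1 + fps_X ^ 2)"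
proof (rule fps_ext)
  fix d
  interpret ring "R Quot J" by (rule ideal.quotient_is_ring[OF ideal_J])
  have "dimension (card (monomials d)) (cls ` range mconst)
      ((\<lambda>f. cls (Phi y f)) ` supported (monomials d))"
    by (intro dimension_supported finite_monomials) (auto simp: monomials_def)
  from dimI[OF subfield_cls_mconst this] show
    "fps_nth (hilbert_series_L cgen n) d = fps_nth ((1 + fps_X) ^ n * (1 + fps_X ^ 2)) d"
    by (simp add: hilbert_series_L_def Lring_def Lconsts_def Lgraded_def assms over_def
        card_monomials[symmetric] image_image cls_homogeneous[symmetric] cls_def[symmetric])
qed

declare One_nat_def [simp del]

lemma y_one [simp]: "y 1 = X 1"
  using y_1 by (simp only: One_nat_def)

section \<open>The ideal is a submodule\<close>

text \<open>The image under \<open>Phi y\<close> is convenient for deciding membership; stability is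
  checked on generators.\<close>

lemma J_eq_genideal: "J = Idl\<^bsub>R\<^esub> (rel y ` {1..n})"
  by (simp add: genideal_rel J_def)

text \<open>Dunkl operators are not multiplicative, so stability is carried from the generators to
  the ideal one variable at a time. The elements of \<open>J\<close> with the property form an
  ideal.\<close>

lemma J_induct [consumes 1, case_names rel zero add mconst X]:
  assumes "f \<in> J" and rel: "\<And>i. i \<in> {1..n} \<Longrightarrow> P (rel y i)" and "P 0"
    and add: "\<And>f g. f \<in> J \<Longrightarrow> g \<in> J \<Longrightarrow> P f \<Longrightarrow> P g \<Longrightarrow> P (f + g)"
    and mconst: "\<And>a f. f \<in> J \<Longrightarrow> P f \<Longrightarrow> P (mconst a * f)"
    and X: "\<And>i f. i \<in> {1..n} \<Longrightarrow> f \<in> J \<Longrightarrow> P f \<Longrightarrow> P (X i * f)"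
  shows "P f"
proof -
  interpret cring R by (rule cring_mpoly_ring)
  have mult: "g * f \<in> J \<and> P (g * f)" if "f \<in> J" "P f" "g \<in> mpolys n" for f g
  proof (rule mpoly_induct[of g "{1..n}"])
    show "keys m \<subseteq> {1..n}" if "m \<in> keys g" for m
      using that \<open>g \<in> mpolys n\<close> by (auto simp: mpolys_def)
  qed (use that in \<open>auto simp: distrib_right mult.assoc
        intro: J_props mpolys_intros mconst X add \<open>P 0\<close> simp del: atLeastAtMost_iff\<close>)
  have "ideal {f \<in> J. P f} R"
    unfolding ideal_mpoly_ring_iff using J_props(1) mult add \<open>P 0\<close> by (auto intro: J_props)
  then have "J \<subseteq> {f \<in> J. P f}"
    by (subst (1) J_eq_genideal, intro genideal_minimal) (auto intro: rel_in_J rel)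
  with \<open>f \<in> J\<close> show ?thesis by auto
qed

section \<open>Quadrics and powers in \<open>J\<close>, and its symmetry\<close>

definition u :: "nat \<Rightarrow> F2c mpoly" where
  "u i = (X i)\<^sup>2 + cc * y n * X i"

lemma rel_1: "rel y 1 = X 1 ^ 4" and rel_n: "rel y n = (y n)\<^sup>2"
  and rel_mid: "i \<in> {2..<n} \<Longrightarrow> rel y i = u i + u 1"
  using n_ge_2
  by (auto simp: rel_def rdeg_def u_def y_mid mpoly_square_add algebra_simps)

lemma mpolys_cc [simp]: "cc \<in> mpolys n" and mpolys_y_n [simp]: "y n \<in> mpolys n"
  using n_ge_2 by (auto simp: cc_def mpolys_closed intro: mpolys_y)

lemma y_n_square: "g \<in> mpolys n \<Longrightarrow> g * (y n)\<^sup>2 \<in> J"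
  using rel_in_J[of n] n_ge_2 by (auto simp: rel_n intro: J_props)

text \<open>Only the index n needs work. The sum of all \<open>u i\<close> is (1 + c) s^2. Adding
  the generators of the middle range, where the n - 2 copies of \<open>u 1\<close> cancel, leaves
  \<open>u n + u 1\<close>.\<close>

lemma u_add_u_1: "i \<in> {1..n} \<Longrightarrow> u i + u 1 \<in> J"
proof -
  have mid: "u i + u 1 \<in> J" if "i \<in> {2..<n}" for i
    using that rel_in_J[of i] rel_mid[OF that] by simp
  have "(\<Sum>i\<in>{1..n}. u i) = (\<Sum>i\<in>{1..n}. X i)\<^sup>2 + cc * y n * (\<Sum>i\<in>{1..n}. X i)"
    by (simp add: u_def sum.distrib mpoly_square_sum sum_distrib_left)
  also have "\<dots> = (1 + cc) * (y n)\<^sup>2"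
    by (simp add: y_n power2_eq_square algebra_simps)
  also have "\<dots> \<in> J" by (intro y_n_square mpolys_intros) auto
  finally have all: "(\<Sum>i\<in>{1..n}. u i) \<in> J" .
  have "(\<Sum>i\<in>{2..<n}. u i + u 1) \<in> J" by (intro J_sum mid)
  also have "(\<Sum>i\<in>{2..<n}. u i + u 1) = (\<Sum>i\<in>{2..<n}. u i)"
    using even_n n_ge_2 by (simp add: sum.distrib mpoly_of_nat)
  finally have "(\<Sum>i\<in>{1..n}. u i) + (\<Sum>i\<in>{2..<n}. u i) \<in> J" using all by (intro J_props)
  then have n: "u n + u 1 \<in> J"
    unfolding sum_split by (simp add: add_ac)
  assume "i \<in> {1..n}"
  with mid n show ?thesis
    unfolding atLeastAtMost_split by (auto simp: J_props)
qed

lemma u_add_u: "i \<in> {1..n} \<Longrightarrow> j \<in> {1..n} \<Longrightarrow> u i + u j \<in> J"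
  using J_props(3)[OF u_add_u_1[of i] u_add_u_1[of j]] by (simp add: add_ac)

text \<open>With v = x_i + x_j, modulo \<open>J\<close> one has v^2 = c s v, so v^3 = c s v^2 = c^2
  s^2 v = 0.\<close>

lemma cube_in_J:
  assumes "i \<in> {1..n}" "j \<in> {1..n}"
  shows "(X i + X j) ^ 3 \<in> J"
proof -
  let ?v = "X i + X j :: F2c mpoly" and ?q = "u i + u j"
  have sq: "?v\<^sup>2 = ?q + cc * y n * ?v"
    by (simp add: u_def mpoly_square_add algebra_simps)
  have "?v ^ 3 = ?v * ?v\<^sup>2" by (simp add: power3_eq_cube power2_eq_square)
  also have "\<dots> = ?v * ?q + cc * y n * ?v\<^sup>2"
    by (subst (1) sq) (simp add: power2_eq_square algebra_simps)
  also have "\<dots> = ?v * ?q + (cc * y n * ?q + (cc\<^sup>2 * ?v) * (y n)\<^sup>2)"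
    by (subst sq) (simp add: power2_eq_square algebra_simps)
  also have "\<dots> \<in> J"
    using assms by (intro J_props(3,4) u_add_u y_n_square mpolys_intros) auto
  finally show ?thesis .
qed

text \<open>The square of \<open>u i + u 1\<close> equals x_i^4 + x_1^4 up to a multiple of s^2,
  which reduces the claim to the generator x_1^4.\<close>

lemma fourth_power_in_J:
  assumes "i \<in> {1..n}"
  shows "X i ^ 4 \<in> J"
proof -
  have sq: "(X i)\<^sup>2 = u i + cc * y n * X i" for i by (simp add: u_def add.assoc)
  have "X i ^ 4 + X 1 ^ 4 = ((X i :: F2c mpoly)\<^sup>2 + (X 1)\<^sup>2)\<^sup>2"
    by (simp add: mpoly_square_add flip: power_mult)
  also have "\<dots> = (u i + u 1)\<^sup>2 + (cc * y n * X i + cc * y n * X 1)\<^sup>2"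
    unfolding sq by (simp add: mpoly_square_add add_ac)
  also have "\<dots> = (u i + u 1) * (u i + u 1) + (cc\<^sup>2 * ((X i)\<^sup>2 + (X 1)\<^sup>2)) * (y n)\<^sup>2"
    by (simp add: power2_eq_square algebra_simps)
  also have "\<dots> \<in> J"
  proof (rule J_props(3))
    have "u i + u 1 \<in> mpolys n" using u_add_u_1[OF assms] J_props(1) by auto
    then show "(u i + u 1) * (u i + u 1) \<in> J" by (intro J_props(4) u_add_u_1 assms)
    show "(cc\<^sup>2 * ((X i)\<^sup>2 + (X 1)\<^sup>2)) * (y n)\<^sup>2 \<in> J"
      by (intro y_n_square mpolys_intros mpolys_cc) (use assms n_ge_2 in auto)
  qed
  finally have "X i ^ 4 + X 1 ^ 4 \<in> J" .
  moreover have "X 1 ^ 4 \<in> J" using rel_in_J[of 1] n_ge_2 by (simp add: rel_1)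
  ultimately have "X i ^ 4 + X 1 ^ 4 + X 1 ^ 4 \<in> J" by (rule J_props)
  then show ?thesis by (simp add: add.assoc)
qed

lemma perm_act_y_n:
  assumes "\<sigma> permutes {1..n}"
  shows "perm_act \<sigma> (y n) = y n"
  using sum.permute[OF assms, of X, symmetric] by (simp add: y_n perm_act_sum o_def)

text \<open>Permutations fix s, permute the \<open>u i\<close> and move x_1^4 to another fourth
  power, so the images of the generators remain in \<open>J\<close>.\<close>

lemma perm_act_J:
  assumes "\<sigma> permutes {1..n}" "f \<in> J"
  shows "perm_act \<sigma> f \<in> J"
  using assms(2)
proof (induction f rule: J_induct)
  have \<sigma>: "\<sigma> i \<in> {1..n}" if "i \<in> {1..n}" for i
    using that permutes_in_image[OF assms(1)] by blast
  have u: "perm_act \<sigma> (u i) = u (\<sigma> i)" for i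
    by (simp add: u_def perm_act_add perm_act_mult perm_act_power perm_act_y_n assms(1) cc_def)
  case (rel i)
  then consider "i = 1" | "i = n" | "i \<in> {2..<n}" by (auto simp: atLeastAtMost_split)
  then show ?case
  proof cases
    case 1
    then show ?thesis
      using fourth_power_in_J[OF \<sigma>, of 1] n_ge_2 by (simp only: rel_1 perm_act_power perm_act_X) auto
  next
    case 2
    then show ?thesis
      using y_n_square[of 1] by (simp add: rel_n perm_act_power perm_act_y_n assms(1) mpolys_closed)
  next
    case 3
    then have "u (\<sigma> i) + u (\<sigma> 1) \<in> J"
      by (intro u_add_u \<sigma>) auto
    with 3 show ?thesis by (simp only: rel_mid perm_act_add u)
  qed
next
  case (X i f)
  then show ?case
    using permutes_in_image[OF assms(1), of i]
    by (auto simp: perm_act_mult intro!: J_props mpolys_X simp del: atLeastAtMost_iff)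
qed (auto simp: perm_act_add perm_act_mult intro: J_props mpolys_closed)

section \<open>Dunkl operators on the generators\<close>

abbreviation D :: "nat \<Rightarrow> F2c mpoly \<Rightarrow> F2c mpoly" where
  "D \<equiv> dunkl cgen n"

lemma transpose_permutes: "k \<in> {1..n} \<Longrightarrow> j \<in> {1..n} \<Longrightarrow> transpose k j permutes {1..n}"
  by (rule permutes_swap_id)

lemma D_symmetric_mult:
  assumes "k \<in> {1..n}" "\<And>\<sigma>. \<sigma> permutes {1..n} \<Longrightarrow> perm_act \<sigma> f = f"
  shows "D k (f * g) = pderiv_var k f * g + f * D k g"
  by (intro dunkl_mult_symmetric assms(2) transpose_permutes) (use assms(1) in auto)

lemma pderiv_y_n: "k \<in> {1..n} \<Longrightarrow> pderiv_var k (y n) = 1"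
  by (simp add: y_n pderiv_var_sum pderiv_var_X)

lemma D_mconst_mult: "D k (mconst a * f) = mconst a * D k f"
  by (rule dunkl_mconst_mult)

lemma D_cc_mult: "D k (cc * f) = cc * D k f"
  by (simp add: cc_def D_mconst_mult)

lemma D_1 [simp]: "D k 1 = 0"
proof -
  have "divided_difference k j 1 = (0::F2c mpoly)" if "k \<noteq> j" for j
    using divided_difference_mconst[OF that, of "1::F2c"] by simp
  then show ?thesis by (simp add: dunkl_def)
qed

lemma D_y_n_mult: "k \<in> {1..n} \<Longrightarrow> D k (y n * f) = f + y n * D k f"
  by (simp add: D_symmetric_mult perm_act_y_n pderiv_y_n)

lemma D_y_n: "k \<in> {1..n} \<Longrightarrow> D k (y n) = 1"
  using D_y_n_mult[of k 1] by simp

lemma D_y_n_square: "k \<in> {1..n} \<Longrightarrow> D k ((y n)\<^sup>2) = 0"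
  by (simp add: power2_eq_square D_y_n_mult D_y_n)

lemma D_X_mult: "D k (X i * f) = (if i = k then f else 0) + X i * D k f +
    cc * (\<Sum>j\<in>{1..n} - {k}. if i = k \<or> i = j then perm_act (transpose k j) f else 0)"
proof -
  have "(\<Sum>j\<in>{1..n} - {k}. divided_difference k j (X i) * perm_act (transpose k j) f) =
      (\<Sum>j\<in>{1..n} - {k}. if i = k \<or> i = j then perm_act (transpose k j) f else 0)"
    by (rule sum.cong) (auto simp: divided_difference_X)
  then show ?thesis
    by (simp add: dunkl_X_mult cc_def mpoly_diff_eq_add)
qed

text \<open>For i = k each of the n - 1 divided differences is 1, and n - 1 is odd; otherwise only j
  = i contributes.\<close>

lemma D_X:
  assumes "k \<in> {1..n}" "i \<in> {1..n}"
  shows "D k (X i) = (if i = k then 1 else 0) + cc"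
proof -
  have 1: "perm_act \<sigma> 1 = (1::F2c mpoly)" for \<sigma> using perm_act_mconst[of \<sigma> "1::F2c"] by simp
  have "odd (n - 1)" using even_n n_ge_2 by simp
  then show ?thesis
    using D_X_mult[of k i 1] assms by (cases "i = k") (simp_all add: 1 mpoly_of_nat)
qed

text \<open>The derivative of a square vanishes, and (x_k^2 + x_j^2) / (x_k + x_j) = x_k + x_j. For
  i = k the sum over j is s because n - 1 is odd.\<close>

lemma D_X_square:
  assumes "k \<in> {1..n}" "i \<in> {1..n}"
  shows "D k ((X i)\<^sup>2) = cc * (if i = k then y n else X i + X k)"
proof (cases "i = k")
  case True
  have "y n = X k + (\<Sum>j\<in>{1..n} - {k}. X j)"
    unfolding y_n using assms by (subst sum.remove) auto
  with True show ?thesis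
    using assms unfolding power2_eq_square D_X_mult by (simp add: D_X algebra_simps)
next
  case False
  then have "(\<Sum>j\<in>{1..n} - {k}. if i = k \<or> i = j then perm_act (transpose k j) (X i) else 0) =
      (X k :: F2c mpoly)"
    using assms by simp
  with False show ?thesis
    using assms unfolding power2_eq_square D_X_mult by (simp add: D_X algebra_simps)
qed

text \<open>The term \<open>cc * y n * X i\<close> of \<open>u i\<close> cancels the dependence on
  i, so \<open>D k\<close> annihilates all sums \<open>u i + u j\<close>.\<close>

lemma D_u:
  assumes "k \<in> {1..n}" "i \<in> {1..n}"
  shows "D k (u i) = cc * X k + cc\<^sup>2 * y n"
  using assms
  by (simp add: u_def dunkl_add mult.assoc D_cc_mult D_y_n_mult D_X D_X_square)
     (simp add: power2_eq_square algebra_simps)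

text \<open>The derivative vanishes and (a^4 + b^4) / (a + b) = (a + b)^3, so only the cubes of
  \<open>cube_in_J\<close> are left.\<close>

lemma D_fourth_power_in_J:
  assumes k: "k \<in> {1..n}"
  shows "D k (X 1 ^ 4) \<in> J"
proof -
  have fourth: "((a::F2c mpoly) + b) * (a + b) ^ 3 = a ^ 4 + b ^ 4" for a b
  proof -
    have "(a + b) * (a + b) ^ 3 = ((a + b)\<^sup>2)\<^sup>2" by (simp flip: power_mult power_Suc)
    also have "\<dots> = a ^ 4 + b ^ 4" by (simp only: mpoly_square_add) (simp flip: power_mult)
    finally show ?thesis .
  qed
  have "divided_difference k j (X 1 ^ 4) = (if k = 1 \<or> j = 1 then (X k + X j) ^ 3 else 0 :: F2c mpoly)"
    if "j \<in> {1..n} - {k}" for j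
    using that by (intro divided_difference_unique)
      (auto simp: mpoly_diff_eq_add fourth perm_act_power transpose_def)
  then have "D k (X 1 ^ 4) = pderiv_var k (X 1 ^ 4) +
      cc * (\<Sum>j\<in>{1..n} - {k}. if k = 1 \<or> j = 1 then (X k + X j) ^ 3 else 0)"
    by (simp add: dunkl_def mpoly_diff_eq_add cc_def)
  also have "pderiv_var k (X 1 ^ 4 :: F2c mpoly) = 0"
    using pderiv_var_square[of k "(X 1)\<^sup>2"] by (simp flip: power_mult)
  finally have "D k (X 1 ^ 4) =
      cc * (\<Sum>j\<in>{1..n} - {k}. if k = 1 \<or> j = 1 then (X k + X j) ^ 3 else 0)" by simp
  also have "\<dots> \<in> J"
    using k by (intro J_props(4) J_sum) (auto intro: cube_in_J J_props)
  finally show ?thesis .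
qed

text \<open>The quadratic generators are sent to 0 and the quartic one to cubes in \<open>J\<close>.
  When a variable is multiplied in, the extra terms are \<open>f\<close> and its images under
  transpositions, which \<open>perm_act_J\<close> keeps in \<open>J\<close>.\<close>

lemma D_J:
  assumes "k \<in> {1..n}" "f \<in> J"
  shows "D k f \<in> J"
  using assms(2)
proof (induction f rule: J_induct)
  case (rel i)
  then consider "i = 1" | "i = n" | "i \<in> {2..<n}" by (auto simp: atLeastAtMost_split)
  then show ?case
  proof cases
    case 1
    then show ?thesis using D_fourth_power_in_J[OF assms(1)] by (simp only: rel_1)
  next
    case 2
    then show ?thesis using assms(1) by (simp add: rel_n D_y_n_square J_props)
  next
    case 3
    then have "D k (u i + u 1) = 0"
      using assms(1) n_ge_2 by (simp add: dunkl_add D_u)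
    with 3 show ?thesis by (simp add: rel_mid J_props)
  qed
next
  case zero
  show ?case using D_mconst_mult[of k 0 0] by (simp add: J_props)
next
  case (X i f)
  have "(if i = k \<or> i = j then perm_act (transpose k j) f else 0) \<in> J" if "j \<in> {1..n} - {k}" for j
    using X(2) perm_act_J[OF transpose_permutes[OF assms(1)]] that J_props(2) by simp
  then have "cc * (\<Sum>j\<in>{1..n} - {k}. if i = k \<or> i = j then perm_act (transpose k j) f else 0) \<in> J"
    by (intro J_props(4) J_sum) auto
  moreover have "X i * D k f \<in> J" using X by (intro J_props(4) mpolys_X)
  moreover have "(if i = k then f else 0) \<in> J" using X J_props(2) by simp
  ultimately show ?case
    unfolding D_X_mult by (intro J_props(3))
qed (auto simp: dunkl_add D_mconst_mult intro: J_props mpolys_closed)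

lemma graded_submodule_J: "graded_submodule cgen n J"
  unfolding graded_submodule_def
  by (auto intro: ideal_J hom_component_J perm_act_J D_J)

section \<open>Every larger submodule contains the socle\<close>

text \<open>For standard exponents these are the mixed monomials, but they multiply by adding
  exponents.\<close>

definition ymon :: "(nat \<Rightarrow> nat) \<Rightarrow> F2c mpoly" where
  "ymon e = (\<Prod>i\<in>{1..n}. y i ^ e i)"

lemma ymon_add: "ymon e * ymon e' = ymon (\<lambda>i. e i + e' i)"
  by (simp add: ymon_def power_add prod.distrib)

lemma mpolys_ymon: "ymon e \<in> mpolys n"
  unfolding ymon_def by (intro mpolys_intros mpolys_y)

lemma mixed_mon_standard:
  assumes "m \<in> standard"
  shows "mixed_mon y m = ymon (lookup m)"
  using assms unfolding mixed_mon_def ymon_def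
  by (intro prod.cong) (auto simp: standard_iff mixed_power_def)

lemma ymon_split:
  assumes "i \<in> {1..n}" "d \<le> e i"
  shows "ymon e = y i ^ d * ymon (e(i := e i - d))"
proof -
  have "ymon e = y i ^ e i * (\<Prod>j\<in>{1..n} - {i}. y j ^ e j)"
    unfolding ymon_def using assms by (intro prod.remove) auto
  also have "(\<Prod>j\<in>{1..n} - {i}. y j ^ e j) = (\<Prod>j\<in>{1..n} - {i}. y j ^ (e(i := e i - d)) j)"
    by (intro prod.cong) auto
  also have "y i ^ e i = y i ^ d * y i ^ (e(i := e i - d)) i"
    using assms by (simp flip: power_add)
  also have "y i ^ d * y i ^ (e(i := e i - d)) i * (\<Prod>j\<in>{1..n} - {i}. y j ^ (e(i := e i - d)) j) =
      y i ^ d * ymon (e(i := e i - d))"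
    unfolding ymon_def mult.assoc using assms by (subst prod.remove[of "{1..n}" i]) auto
  finally show ?thesis .
qed

text \<open>At 1 and n the power itself is a relation. In between the factor s helps: modulo
  \<open>J\<close>, s z_i^2 is congruent to c s^2 z_i, which lies in \<open>J\<close>.\<close>

lemma ymon_in_J:
  assumes "e n \<ge> 1" and "i \<in> {1..n}" "e i \<ge> rdeg i"
  shows "ymon e \<in> J"
proof -
  have n: "n \<in> {1..n}" using n_ge_2 by simp
  show ?thesis
  proof (cases "i \<in> {2..<n}")
    case False
    then have "rel y i = y i ^ rdeg i" by (simp only: rel_def if_False add_0_right)
    then have "y i ^ rdeg i \<in> J" using rel_in_J[OF assms(2)] by simp
    then show ?thesis
      unfolding ymon_split[where e = e, OF assms(2,3)] by (metis J_props(4) mpolys_ymon mult.commute)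
  next
    case True
    define e' where "e' = e(i := e i - rdeg i)"
    have "ymon e = y i ^ rdeg i * (y n * ymon (e'(n := e' n - 1)))"
      using ymon_split[where e = e, OF assms(2,3)] ymon_split[OF n, of 1 e'] assms(1) True by (simp add: e'_def)
    also have "y i ^ rdeg i = rel y i + cc * y n * y i"
      using True by (simp add: rel_def add.assoc)
    also have "(rel y i + cc * y n * y i) * (y n * ymon (e'(n := e' n - 1))) =
        (y n * ymon (e'(n := e' n - 1))) * rel y i +
        (cc * y i * ymon (e'(n := e' n - 1))) * (y n)\<^sup>2"
      by (simp add: power2_eq_square algebra_simps)
    also have "\<dots> \<in> J"
    proof (rule J_props(3))
      show "(y n * ymon (e'(n := e' n - 1))) * rel y i \<in> J"
        by (intro J_props(4) rel_in_J assms(2) mpolys_closed mpolys_y_n mpolys_ymon)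
      show "(cc * y i * ymon (e'(n := e' n - 1))) * (y n)\<^sup>2 \<in> J"
        by (intro y_n_square mpolys_closed mpolys_cc mpolys_y mpolys_ymon assms(2))
    qed
    finally show ?thesis .
  qed
qed

text \<open>Multiplying a normal form by the monomial complementary to a suitably minimal exponent
  sends that term to a multiple of the socle generator and all other terms into
  \<open>J\<close>.\<close>

lemma socle_in:
  assumes I: "ideal I R" and "J \<subseteq> I" and "I \<noteq> J"
  shows "ymon (\<lambda>i. rdeg i - 1) \<in> I"
proof -
  from assms(2,3) obtain f where f: "f \<in> I" "f \<notin> J" by auto
  have Iprops: "I \<subseteq> mpolys n" "\<And>f g. f \<in> I \<Longrightarrow> g \<in> I \<Longrightarrow> f + g \<in> I"
    "\<And>f g. f \<in> I \<Longrightarrow> g \<in> mpolys n \<Longrightarrow> g * f \<in> I" "0 \<in> I"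
    using I unfolding ideal_mpoly_ring_iff by auto
  have "f \<in> mpolys n" using f(1) Iprops(1) by auto
  then obtain h where h: "h \<in> supported standard" "f + Phi y h \<in> J"
    using standard_rep by metis
  have "f + (f + Phi y h) \<in> I" using Iprops(2)[OF f(1)] h(2) assms(2) by blast
  then have Phi_h: "Phi y h \<in> I" by simp
  have "h \<noteq> 0" using h f by auto
  \<comment> \<open>The square of \<open>z\<^sub>i\<close> lies in \<open>J\<close> only after multiplication by \<open>s\<close>, so the exponent of \<open>s\<close> is
    minimized before the degree.\<close>
  obtain m0 where m0: "m0 \<in> keys h" "\<And>m. m \<in> keys h \<Longrightarrow> lookup m0 n \<le> lookup m n"
    using ex_is_arg_min_if_finite[of "keys h" "\<lambda>m. lookup m n"] \<open>h \<noteq> 0\<close>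
    by (auto simp: is_arg_min_linorder)
  define K where "K = {m \<in> keys h. lookup m n = lookup m0 n}"
  have "finite K" "K \<noteq> {}" using m0 by (auto simp: K_def)
  then obtain m where m: "m \<in> K" "\<And>m'. m' \<in> K \<Longrightarrow> mdeg m \<le> mdeg m'"
    using ex_is_arg_min_if_finite[of K mdeg] by (auto simp: is_arg_min_linorder)
  have mh: "m \<in> keys h" "\<And>m'. m' \<in> keys h \<Longrightarrow> lookup m n \<le> lookup m' n"
    using m m0 by (auto simp: K_def)
  have std: "m' \<in> standard" if "m' \<in> keys h" for m' using that h by (auto simp: supported_def)
  define q where "q = ymon (\<lambda>i. rdeg i - 1 - lookup m i)"
  have n: "n \<in> {1..n}" "rdeg n = 2" using n_ge_2 by (auto simp: rdeg_def)
  have bound: "lookup m i < rdeg i" if "i \<in> {1..n}" for i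
    using std[OF mh(1)] that by (simp add: standard_iff)
  have off: "q * mixed_mon y m' \<in> J" if m': "m' \<in> keys h" "m' \<noteq> m" for m'
  proof -
    let ?e = "\<lambda>i. rdeg i - 1 - lookup m i + lookup m' i"
    have "?e n \<ge> 1" using mh(2)[OF m'(1)] bound[OF n(1)] n by simp
    \<comment> \<open>If \<open>m'\<close> were bounded by \<open>m\<close> everywhere, the
      exponents of s would agree, so \<open>m'\<close> would lie in \<open>K\<close> with smaller
      degree than \<open>m\<close>.\<close>
    moreover have "\<exists>i\<in>{1..n}. lookup m i < lookup m' i"
    proof (rule ccontr)
      assume "\<not> ?thesis"
      then have le: "lookup m' i \<le> lookup m i" if "i \<in> {1..n}" for i using that by (auto simp: not_less)
      then have "lookup m' n = lookup m n" using mh(2)[OF m'(1)] n by (simp add: le_antisym)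
      then have "m' \<in> K" using m m' by (simp add: K_def)
      then have deg: "mdeg m \<le> mdeg m'" by (rule m)
      have keys: "keys m \<subseteq> {1..n}" "keys m' \<subseteq> {1..n}"
        using std[OF mh(1)] std[OF m'(1)] by (auto simp: standard_def)
      have "\<exists>i. lookup m' i \<noteq> lookup m i" using m'(2) by (metis poly_mapping_eqI)
      then obtain i where i: "lookup m' i \<noteq> lookup m i" by auto
      then have "i \<in> {1..n}" using keys by (metis in_keys_iff subsetD)
      with i have "\<exists>i\<in>{1..n}. lookup m' i < lookup m i" using le by (metis le_neq_implies_less)
      then have "(\<Sum>i\<in>{1..n}. lookup m' i) < (\<Sum>i\<in>{1..n}. lookup m i)"
        using le by (intro sum_strict_mono_ex1) auto
      with deg keys show False by (simp add: mdeg_superset[of "{1..n}"])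
    qed
    then obtain i where "i \<in> {1..n}" "lookup m i < lookup m' i" by auto
    moreover from this bound[of i] have "?e i \<ge> rdeg i" by simp
    ultimately have "ymon ?e \<in> J" by (intro ymon_in_J) auto
    then show ?thesis using std[OF m'(1)] by (simp add: q_def mixed_mon_standard ymon_add)
  qed
  have "q * mixed_mon y m = ymon (\<lambda>i. rdeg i - 1 - lookup m i + lookup m i)"
    using std[OF mh(1)] by (simp add: q_def mixed_mon_standard ymon_add)
  also have "\<dots> = ymon (\<lambda>i. rdeg i - 1)"
    unfolding ymon_def by (intro prod.cong refl arg_cong2[of _ _ _ _ "(^)"]) (use bound in fastforce)
  finally have on: "q * mixed_mon y m = ymon (\<lambda>i. rdeg i - 1)" .
  have "q * Phi y h = (\<Sum>m\<in>keys h. mconst (lookup h m) * (q * mixed_mon y m))"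
    by (simp add: Phi_def linext_def sum_distrib_left mult_ac)
  also have "\<dots> = mconst (lookup h m) * (q * mixed_mon y m) +
      (\<Sum>m'\<in>keys h - {m}. mconst (lookup h m') * (q * mixed_mon y m'))"
    using mh(1) by (intro sum.remove) auto
  finally have sum: "q * Phi y h = mconst (lookup h m) * ymon (\<lambda>i. rdeg i - 1) +
      (\<Sum>m'\<in>keys h - {m}. mconst (lookup h m') * (q * mixed_mon y m'))"
    unfolding on .
  have "q * Phi y h \<in> I" using Phi_h by (intro Iprops) (auto simp: q_def mpolys_ymon)
  moreover have "(\<Sum>m'\<in>keys h - {m}. mconst (lookup h m') * (q * mixed_mon y m')) \<in> I"
    by (intro subsetD[OF assms(2)] J_sum J_props(4)[OF off] mpolys_closed) auto
  ultimately have "q * Phi y h + (\<Sum>m'\<in>keys h - {m}. mconst (lookup h m') * (q * mixed_mon y m')) \<in> I"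
    by (rule Iprops)
  then have "mconst (lookup h m) * ymon (\<lambda>i. rdeg i - 1) \<in> I"
    by (simp add: sum add.assoc)
  then have "mconst (inverse (lookup h m)) * (mconst (lookup h m) * ymon (\<lambda>i. rdeg i - 1)) \<in> I"
    by (rule Iprops(3)) (rule mpolys_closed)
  moreover have "lookup h m \<noteq> 0" using mh(1) by (simp add: in_keys_iff)
  ultimately show ?thesis
    by (simp add: mult.assoc[symmetric] mconst_mult[symmetric])
qed

section \<open>Reduction modulo \<open>c\<close>\<close>

text \<open>Coefficients in F_2[c], where reduction modulo c makes sense.\<close>

definition integral :: "F2c mpoly set" where
  "integral = {f. \<forall>m. lookup f m \<in> range to_fract}"

lemma range_to_fract_closed:
  "0 \<in> range to_fract" "1 \<in> range to_fract"
  "a \<in> range to_fract \<Longrightarrow> b \<in> range to_fract \<Longrightarrow> a + b \<in> range to_fract"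
  "a \<in> range to_fract \<Longrightarrow> b \<in> range to_fract \<Longrightarrow> a * b \<in> range to_fract"
  "of_nat k \<in> range to_fract"
  for a b :: F2c
proof -
  show "0 \<in> range to_fract" "1 \<in> range to_fract"
    by (metis to_fract_0 rangeI) (metis to_fract_1 rangeI)
  show "a \<in> range to_fract \<Longrightarrow> b \<in> range to_fract \<Longrightarrow> a + b \<in> range to_fract"
    by (auto simp flip: to_fract_add)
  show "a \<in> range to_fract \<Longrightarrow> b \<in> range to_fract \<Longrightarrow> a * b \<in> range to_fract"
    by (auto simp flip: to_fract_mult)
  have "of_nat k = to_fract (of_nat k)" by (induction k) simp_all
  then show "of_nat k \<in> range to_fract" by blast
qed

lemma integral_add: "f \<in> integral \<Longrightarrow> g \<in> integral \<Longrightarrow> f + g \<in> integral"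
  and integral_0: "0 \<in> integral"
  by (auto simp: integral_def lookup_add range_to_fract_closed simp del: image_iff
      intro: range_to_fract_closed)

lemma integral_sum: "(\<And>x. x \<in> A \<Longrightarrow> h x \<in> integral) \<Longrightarrow> sum h A \<in> integral"
  by (induction A rule: infinite_finite_induct) (simp_all add: integral_add integral_0)

lemma integral_single: "a \<in> range to_fract \<Longrightarrow> single m a \<in> integral"
  using range_to_fract_closed(1) by (simp add: integral_def lookup_single when_def)

lemma integral_mult:
  assumes "f \<in> integral" "g \<in> integral"
  shows "f * g \<in> integral"
proof -
  have "f * g = (\<Sum>m\<in>keys f. \<Sum>m'\<in>keys g. single (m + m') (lookup f m * lookup g m'))"
    by (subst (1) sum_single_lookup[of f, symmetric], subst (1) sum_single_lookup[of g, symmetric])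
       (simp add: sum_product mult_single)
  also have "\<dots> \<in> integral"
    using assms by (intro integral_sum integral_single range_to_fract_closed) (auto simp: integral_def)
  finally show ?thesis .
qed

lemma integral_X: "X i \<in> integral" and integral_1: "1 \<in> integral" and integral_cc: "cc \<in> integral"
  using range_to_fract_closed(2)
  by (auto simp: X_def cc_def mconst_def cgen_def simp flip: to_fract_def single_one
      intro!: integral_single simp del: single_one)

lemma integral_power: "f \<in> integral \<Longrightarrow> f ^ k \<in> integral"
  by (induction k) (simp_all add: integral_1 integral_mult)

lemma integral_prod: "(\<And>x. x \<in> A \<Longrightarrow> h x \<in> integral) \<Longrightarrow> prod h A \<in> integral"
  by (induction A rule: infinite_finite_induct) (simp_all add: integral_1 integral_mult)

lemma integral_y: "y i \<in> integral"
  by (auto simp: y_def intro!: integral_sum integral_add integral_X)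

lemmas integral_intros = integral_add integral_sum integral_mult integral_X integral_1 integral_cc
  integral_power integral_prod integral_y

lemma integral_pderiv: "f \<in> integral \<Longrightarrow> pderiv_var k f \<in> integral"
  unfolding pderiv_var_def
  by (intro integral_sum integral_single range_to_fract_closed) (simp add: integral_def)

text \<open>The twisted Leibniz rule avoids division: the quotient is built up along with
  \<open>f\<close>, starting from 1, -1 and 0 on the variables.\<close>

lemma integral_divided_difference:
  assumes "f \<in> integral" "k \<noteq> j"
  shows "divided_difference k j f \<in> integral"
proof -
  have "f \<in> integral \<and> divided_difference k j f \<in> integral"
  proof (rule mpoly_induct[of f UNIV])
    have "divided_difference k j 0 = (0::F2c mpoly)"
      using divided_difference_mconst[OF assms(2), of "0::F2c"] by simp
    then show "0 \<in> integral \<and> divided_difference k j 0 \<in> integral" by (simp add: integral_0)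
    show "mconst (lookup f m) \<in> integral \<and> divided_difference k j (mconst (lookup f m)) \<in> integral"
      for m
    proof -
      have "mconst (lookup f m) \<in> integral"
        unfolding mconst_def using assms(1) by (intro integral_single) (simp add: integral_def)
      then show ?thesis using assms(2) by (simp add: integral_0)
    qed
  next
    fix i g assume g: "g \<in> integral \<and> divided_difference k j g \<in> integral"
    have "divided_difference k j (X i) \<in> integral"
      using assms(2) by (simp add: divided_difference_X integral_1 integral_0)
    \<comment> \<open>The factors are taken in this order so that the transposition falls on
      \<open>X i\<close> and not on \<open>g\<close>.\<close>
    then have "divided_difference k j (g * X i) \<in> integral"
      using g assms(2) unfolding divided_difference_mult[OF assms(2)]
      by (auto intro!: integral_intros)
    with g show "X i * g \<in> integral \<and> divided_difference k j (X i * g) \<in> integral"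
      by (simp add: mult.commute integral_intros)
  next
    fix g h :: "F2c mpoly"
    assume "g \<in> integral \<and> divided_difference k j g \<in> integral"
      "h \<in> integral \<and> divided_difference k j h \<in> integral"
    then show "g + h \<in> integral \<and> divided_difference k j (g + h) \<in> integral"
      using assms(2) by (simp add: divided_difference_add integral_add)
  qed simp
  then show ?thesis by simp
qed

lemma D_eq_pderiv_mod_c:
  assumes "f \<in> integral"
  obtains r where "r \<in> integral" "D k f = pderiv_var k f + cc * r"
proof
  let ?r = "\<Sum>j\<in>{1..n} - {k}. divided_difference k j f"
  show "?r \<in> integral"
    using assms by (intro integral_sum integral_divided_difference) auto
  show "D k f = pderiv_var k f + cc * ?r"
    by (simp add: dunkl_def cc_def mpoly_diff_eq_add)
qed

lemma integral_D: "f \<in> integral \<Longrightarrow> D k f \<in> integral"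
  by (rule D_eq_pderiv_mod_c[of f k]) (auto intro!: integral_intros integral_pderiv)

lemma hom_component_0: "hom_component 0 f = mconst (lookup f 0)"
  by (rule poly_mapping_eqI)
     (auto simp: lookup_hom_component mconst_def lookup_single when_def mdeg_def
       intro!: arg_cong[of _ _ "lookup f"] poly_mapping_eqI simp: in_keys_iff)

section \<open>From the socle generator to a nonzero constant\<close>

lemma one_in_if_socle_in:
  assumes I: "graded_submodule cgen n I" and socle: "ymon (\<lambda>i. rdeg i - 1) \<in> I"
  shows "1 \<in> I"
proof -
  have Iprops: "\<And>f g. f \<in> I \<Longrightarrow> g \<in> I \<Longrightarrow> f + g \<in> I"
    "\<And>f g. f \<in> I \<Longrightarrow> g \<in> mpolys n \<Longrightarrow> g * f \<in> I" "0 \<in> I"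
    and ID: "\<And>k f. k \<in> {1..n} \<Longrightarrow> f \<in> I \<Longrightarrow> D k f \<in> I"
    and Ih: "\<And>f. f \<in> I \<Longrightarrow> hom_component 0 f \<in> I"
    using I unfolding graded_submodule_def ideal_mpoly_ring_iff by auto
  \<comment> \<open>\<open>red f\<close> says that \<open>f\<close>, modulo c, is the reduction of
    an integral element of \<open>I\<close>. On such reductions \<open>D k\<close> acts as a partial
    derivative.\<close>
  define red where "red f \<longleftrightarrow> f \<in> integral \<and> (\<exists>r\<in>integral. f + cc * r \<in> I)" for f
  have red_pderiv: "red (pderiv_var k f)" if k: "k \<in> {1..n}" and f: "red f" for k f
  proof -
    from f obtain r where r: "r \<in> integral" "f + cc * r \<in> I" and f': "f \<in> integral"
      by (auto simp: red_def)
    obtain r' where r': "r' \<in> integral" "D k f = pderiv_var k f + cc * r'"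
      using D_eq_pderiv_mod_c[OF f'] .
    have "D k (f + cc * r) \<in> I" by (intro ID k r)
    also have "D k (f + cc * r) = pderiv_var k f + cc * (r' + D k r)"
      by (simp add: dunkl_add D_cc_mult r' distrib_left add.assoc)
    finally show ?thesis
      using r(1) r'(1) f' unfolding red_def
      by (intro conjI integral_pderiv bexI[of _ "r' + D k r"] integral_add integral_D)
  qed
  have red_add: "red (f + g)" if "red f" "red g" for f g
  proof -
    from that obtain r s where r: "r \<in> integral" "f + cc * r \<in> I" "s \<in> integral" "g + cc * s \<in> I"
      and fg: "f \<in> integral" "g \<in> integral"
      by (auto simp: red_def)
    have "f + g + cc * (r + s) = (f + cc * r) + (g + cc * s)" by (simp add: algebra_simps)
    also have "\<dots> \<in> I" by (intro Iprops r)
    finally show ?thesis using r fg unfolding red_def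
      by (intro conjI bexI[of _ "r + s"] integral_add)
  qed
  \<comment> \<open>Both derivatives of s are 1, so their sum kills s and the factor
    \<open>y n\<close> is preserved.\<close>
  define \<delta> where "\<delta> k f = pderiv_var k f + pderiv_var n f" for k and f :: "F2c mpoly"
  have n: "n \<in> {1..n}" using n_ge_2 by simp
  have red_\<delta>: "red (\<delta> k f)" if "k \<in> {1..n}" "red f" for k f
    unfolding \<delta>_def using that n by (intro red_add red_pderiv)
  have \<delta>_mult: "\<delta> k (f * g) = \<delta> k f * g + f * \<delta> k g" for k f g
    by (simp add: \<delta>_def pderiv_var_mult algebra_simps)
  have \<delta>_n: "\<delta> k (y n) = 0" if "k \<in> {1..n}" for k
    using that n by (simp add: \<delta>_def pderiv_y_n)
  have \<delta>_1: "\<delta> k (X 1) = (if k = 1 then 1 else 0)" for k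
    using n_ge_2 by (simp add: \<delta>_def pderiv_var_X)
  have \<delta>_y: "\<delta> k (y i) = (if k = i then 1 else 0)" if "i \<in> {2..<n}" "k \<noteq> 1" for k i
    using that n_ge_2 by (simp add: y_mid \<delta>_def pderiv_var_add pderiv_var_X)
  have \<delta>_prod: "\<delta> k (\<Prod>i\<in>A. y i) = 0" if "finite A" "A \<subseteq> {2..<n}" "k \<in> {2..<n}" "k \<notin> A" for k A
    using that
  proof (induction A)
    case empty
    then show ?case by (simp add: \<delta>_def)
  next
    case (insert i A)
    then have "k \<noteq> i" "i \<in> {2..<n}" "k \<noteq> 1" by auto
    with insert show ?case by (simp add: \<delta>_mult \<delta>_y)
  qed
  have \<delta>_pow: "\<delta> k (X 1 ^ 3) = (if k = 1 then (X 1)\<^sup>2 else 0)" for k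
    by (simp add: power3_eq_cube power2_eq_square \<delta>_mult \<delta>_1)
  have "ymon (\<lambda>i. rdeg i - 1) = y n * X 1 ^ 3 * (\<Prod>i\<in>{2..<n}. y i)"
  proof -
    have "ymon (\<lambda>i. rdeg i - 1) =
        y 1 ^ (rdeg 1 - 1) * (y n ^ (rdeg n - 1) * (\<Prod>i\<in>{2..<n}. y i ^ (rdeg i - 1)))"
      using n_ge_2 unfolding ymon_def atLeastAtMost_split by (subst prod.insert; auto)+
    also have "(\<Prod>i\<in>{2..<n}. y i ^ (rdeg i - 1)) = (\<Prod>i\<in>{2..<n}. y i)"
      by (intro prod.cong) (auto simp: rdeg_def)
    finally show ?thesis using n_ge_2 by (simp add: rdeg_def mult_ac)
  qed
  then have "y n * X 1 ^ 3 * (\<Prod>i\<in>{2..<n}. y i) + cc * 0 \<in> I" using socle by simp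
  then have "red (y n * X 1 ^ 3 * (\<Prod>i\<in>{2..<n}. y i))"
    unfolding red_def by (intro conjI bexI[of _ 0] integral_intros integral_0)
  moreover have "red (y n * X 1 ^ 3)" if "finite A" "A \<subseteq> {2..<n}" "red (y n * X 1 ^ 3 * (\<Prod>i\<in>A. y i))" for A
    using that
  proof (induction A)
    case (insert k A)
    then have k: "k \<in> {2..<n}" "k \<in> {1..n}" "k \<noteq> 1" by auto
    have "\<delta> k (y n * X 1 ^ 3 * (\<Prod>i\<in>insert k A. y i)) = y n * X 1 ^ 3 * (\<Prod>i\<in>A. y i)"
      using insert.hyps insert.prems k
      by (simp add: \<delta>_mult \<delta>_n \<delta>_y \<delta>_prod \<delta>_pow)
    with red_\<delta>[OF k(2) insert.prems(2)] show ?case using insert by auto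
  qed simp
  ultimately have "red (y n * X 1 ^ 3)" by blast
  then have "red (\<delta> 1 (y n * X 1 ^ 3))" using n_ge_2 by (intro red_\<delta>) auto
  also have "\<delta> 1 (y n * X 1 ^ 3) = y n * (X 1)\<^sup>2"
    using n_ge_2 by (simp add: \<delta>_mult \<delta>_pow \<delta>_n)
  finally obtain r where r: "r \<in> integral" "y n * (X 1)\<^sup>2 + cc * r \<in> I"
    by (auto simp: red_def)
  have one: "1 \<in> {1..n}" using n_ge_2 by simp
  obtain r1 where r1: "r1 \<in> integral" "D 1 r = pderiv_var 1 r + cc * r1"
    using D_eq_pderiv_mod_c[OF r(1)] .
  \<comment> \<open>The second derivative of \<open>r\<close> is zero, so \<open>D 1\<close> leaves
    only a multiple of \<open>cc\<close>; with the factor \<open>cc\<close> in front of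
    \<open>r\<close> this has order c^2.\<close>
  obtain r2 where r2: "r2 \<in> integral" "D 1 (pderiv_var 1 r) = cc * r2"
    using D_eq_pderiv_mod_c[OF integral_pderiv[OF r(1)], of 1 1]
    by (auto simp: pderiv_var_twice)
  define r3 where "r3 = D 1 (r2 + D 1 r1)"
  have r3: "r3 \<in> integral" unfolding r3_def by (intro integral_D integral_add r1 r2)
  \<comment> \<open>The constant sought is itself a multiple of c and would be lost modulo c, so
    these three steps are computed exactly.\<close>
  have "D 1 (D 1 (D 1 (y n * (X 1)\<^sup>2 + cc * r))) \<in> I"
    by (intro ID one r)
  also have "D 1 (y n * (X 1)\<^sup>2 + cc * r) =
      (X 1)\<^sup>2 + cc * (y n)\<^sup>2 + cc * pderiv_var 1 r + cc * (cc * r1)"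
    using one by (simp add: dunkl_add D_cc_mult D_y_n_mult D_X_square r1)
      (simp add: power2_eq_square algebra_simps)
  also have "D 1 \<dots> = cc * y n + cc * (cc * (r2 + D 1 r1))"
    using one by (simp add: dunkl_add D_cc_mult D_X_square D_y_n_square r2 algebra_simps)
  also have "D 1 \<dots> = cc + cc * (cc * r3)"
    using one by (simp add: dunkl_add D_cc_mult D_y_n r3_def)
  finally have const: "hom_component 0 (cc + cc * (cc * r3)) \<in> I" by (rule Ih)
  obtain p where p: "lookup r3 0 = to_fract p" using r3 by (auto simp: integral_def)
  have "hom_component 0 (cc + cc * (cc * r3)) = mconst (cgen + cgen * (cgen * to_fract p))"
    by (simp add: hom_component_0 lookup_add cc_def lookup_mconst_mult p) (simp add: mconst_def)
  also have "cgen + cgen * (cgen * to_fract p) = to_fract ([:0, 1:] + [:0, 1:] * ([:0, 1:] * p))"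
    by (simp only: cgen_def to_fract_add to_fract_mult flip: to_fract_def)
  finally have "mconst (to_fract ([:0, 1:] + [:0, 1:] * ([:0, 1:] * p))) \<in> I"
    using const by simp
  then have "mconst (inverse (to_fract ([:0, 1:] + [:0, 1:] * ([:0, 1:] * p)))) *
      mconst (to_fract ([:0, 1:] + [:0, 1:] * ([:0, 1:] * p))) \<in> I"
    by (intro Iprops mpolys_closed)
  \<comment> \<open>The coefficient of c in c + c^2 p is 1 whatever \<open>p\<close> is, so the
    constant is a unit of the field.\<close>
  moreover have "Polynomial.coeff ([:0, 1:] + [:0, 1:] * ([:0, 1:] * p)) 1 = 1"
    by (simp add: One_nat_def)
  then have "to_fract ([:0, 1:] + [:0, 1:] * ([:0, 1:] * p)) \<noteq> 0"
    by (metis Polynomial.coeff_0 to_fract_eq_0_iff zero_neq_one)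
  ultimately show ?thesis by (simp flip: mconst_mult)
qed

lemma Jmax_eq: "Jmax cgen n = J"
proof -
  have "maximal_proper_graded_submodule cgen n J"
    unfolding maximal_proper_graded_submodule_def
  proof (intro conjI allI impI)
    show "J \<noteq> mpolys n" using one_not_in_J mpolys_closed(2) by auto
    fix I assume I: "graded_submodule cgen n I \<and> I \<noteq> mpolys n \<and> J \<subseteq> I"
    then have ideal: "ideal I R" by (simp add: graded_submodule_def)
    show "I = J"
    proof (rule ccontr)
      assume "I \<noteq> J"
      with I have "1 \<in> I" by (intro one_in_if_socle_in socle_in ideal) auto
      then have "g * 1 \<in> I" if "g \<in> mpolys n" for g
        using that ideal unfolding ideal_mpoly_ring_iff by blast
      with I ideal show False unfolding ideal_mpoly_ring_iff by auto
    qed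
  qed (rule graded_submodule_J)
  then show ?thesis
    unfolding Jmax_def by (rule the1_equality[OF maximal_proper_graded_submodule_ex1])
qed

end

theorem theorem5p1:
  fixes n :: nat
  assumes "n \<ge> 2" and "even n"
  shows "(\<exists>qs g.
            length qs = n - 1 \<and> (\<forall>q\<in>set qs. homogeneous 2 q) \<and> homogeneous 4 g \<and>
            regular_sequence (mpoly_ring n) (qs @ [g]) \<and>
            Jmax cgen n = Idl\<^bsub>mpoly_ring n\<^esub> (set (qs @ [g]))) \<and>
         hilbert_series_L cgen n = (1 + fps_X) ^ n * (1 + fps_X ^ 2)"
proof
  interpret even_rank n using assms by unfold_locales
  show "hilbert_series_L cgen n = (1 + fps_X) ^ n * (1 + fps_X ^ 2)"
    by (rule hilbert_series_if_Jmax_eq[OF Jmax_eq])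
  \<comment> \<open>The index 1 of the quartic comes last, after the n - 1 indices of the
    quadrics.\<close>
  let ?js = "[2..<Suc n]"
  have set: "set (?js @ [1]) = {1..n}" using assms(1) by auto
  have "regular_sequence (mpoly_ring n) (map (rel y) (?js @ [1]))"
    using set by (intro regular_sequence_rel) auto
  moreover have "Jmax cgen n = Idl\<^bsub>mpoly_ring n\<^esub> (set (map (rel y) (?js @ [1])))"
    unfolding Jmax_eq J_eq_genideal set_map set ..
  moreover have "homogeneous 2 q" if "q \<in> set (map (rel y) ?js)" for q
  proof -
    from that obtain i where "q = rel y i" "i \<noteq> 1" by auto
    then show ?thesis using homogeneous_rel[of i] by (simp add: rdeg_def)
  qed
  moreover have "homogeneous 4 (rel y 1)"
    using homogeneous_rel[of 1] by (simp add: rdeg_def)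
  ultimately show "\<exists>qs g. length qs = n - 1 \<and> (\<forall>q\<in>set qs. homogeneous 2 q) \<and> homogeneous 4 g \<and>
            regular_sequence (mpoly_ring n) (qs @ [g]) \<and>
            Jmax cgen n = Idl\<^bsub>mpoly_ring n\<^esub> (set (qs @ [g]))"
    by (intro exI[of _ "map (rel y) ?js"] exI[of _ "rel y 1"]) auto
qed

end
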